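(* Let $\mathcal{C}$ be a $\operatorname{Hom}$-finite Krull-Schmidt triangulated category and let $\mathcal{T}$ be a rigid contravariantly finite subcategory of $\mathcal{C}$. Let $X\in\mathcal{T}\ast\mathcal{T}[1]$ be an object having no direct summands in $\mathcal{T}[1]$. Then $\operatorname{pd}\mathsf{H}X\leq 1$ if and only if $\mathcal{I}_X(\mathcal{T}[1])=0$.
   Context: Conventions: $[1]$ is the shift functor of $\mathcal{C}$. $\mathcal{T}$ is a full subcategory of $\mathcal{C}$ closed under isomorphisms, direct sums and direct summands; $\mathcal{T}[i]$ is the full subcategory of objects isomorphic to $T[i]$ with $T\in\mathcal{T}$. 'Having no direct summands in $\mathcal{T}[1]$' means having no nonzero direct summands in $\mathcal{T}[1]$. $\mathcal{T}$ is rigid if $\operatorname{Hom}_{\mathcal{C}}(T,T'[1])=0$ for all $T,T'\in\mathcal{T}$. A morphism $f:T\to X$ with $T\in\mathcal{T}$ is a right $\mathcal{T}$-approximation of $X$ if every morphism from an object of $\mathcal{T}$ to $X$ factors through $f$; $\mathcal{T}$ is contravariantly finite if every $X\in\mathcal{C}$ admits a right $\mathcal{T}$-approximation. For subcategories $\mathcal{X},\mathcal{Y}$ of $\mathcal{C}$, $\mathcal{X}\ast\mathcal{Y}$ is the full subcategory of all objects $Z$ appearing in a triangle $X\to Z\to Y\to X[1]$ with $X\in\mathcal{X}$, $Y\in\mathcal{Y}$. Thus $X\in\mathcal{T}\ast\mathcal{T}[1]$ iff there is a triangle $T_1\to T_0\to X\to T_1[1]$ with $T_0,T_1\in\mathcal{T}$.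 $\operatorname{mod}\mathcal{T}$ is the category of finitely presented contravariant (additive) functors on $\mathcal{T}$; it is abelian with enough projectives, and $\operatorname{pd}$ denotes projective dimension in it. $\mathsf{H}:\mathcal{C}\to\operatorname{mod}\mathcal{T}$ is the functor $\mathsf{H}(X)=\operatorname{Hom}_{\mathcal{C}}(-,X)|_{\mathcal{T}}$. $\mathcal{I}_X(\mathcal{T}[1])$ is the ideal of $\mathcal{T}[1]$ consisting of all morphisms between objects of $\mathcal{T}[1]$ that factor (in $\mathcal{C}$) through $X$; $\mathcal{I}_X(\mathcal{T}[1])=0$ means all such morphisms are zero. *)

theory Defs
  imports
    "HOL-Library.Extended_Nat"
    "HOL-Algebra.Ideal"
    "Jordan_Normal_Form.Missing_VectorSpace"
begin

section \<open>Linear categories\<close>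

text \<open>
  A category enriched in \<open>k\<close>-vector spaces. The space of morphisms from \<open>X\<close> to \<open>Y\<close> is the
  \<^type>\<open>module\<close> record \<open>Hom C X Y\<close>; its fields \<^const>\<open>monoid.mult\<close> and \<^const>\<open>monoid.one\<close>
  are unconstrained and never used. Composition is written in the usual order,
  \<open>g \<bullet>\<^bsub>C\<^esub> f\<close> meaning first \<open>f\<close>, then \<open>g\<close>.
\<close>

record ('k, 'o, 'm) lin_cat =
  Obj :: "'o set"
  Hom :: "'o \<Rightarrow> 'o \<Rightarrow> ('k, 'm) module"
  cmp :: "'m \<Rightarrow> 'm \<Rightarrow> 'm" (infixr "\<bullet>\<index>" 75)
  idm :: "'o \<Rightarrow> 'm"

abbreviation arr :: "('k, 'o, 'm, 'z) lin_cat_scheme \<Rightarrow> 'o \<Rightarrow> 'o \<Rightarrow> 'm set" where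
  "arr C X Y \<equiv> carrier (Hom C X Y)"

locale linear_category =
  fixes k :: "('k, 'r) ring_scheme"
    and C :: "('k, 'o, 'm, 'z) lin_cat_scheme" (structure)
  assumes field_k: "field k"
    and hom_vectorspace:
      "\<lbrakk>X \<in> Obj C; Y \<in> Obj C\<rbrakk> \<Longrightarrow> vectorspace k (Hom C X Y)"
    and hom_disjoint:
      "\<lbrakk>X \<in> Obj C; Y \<in> Obj C; X' \<in> Obj C; Y' \<in> Obj C; f \<in> arr C X Y; f \<in> arr C X' Y'\<rbrakk>
        \<Longrightarrow> X = X' \<and> Y = Y'"
    and id_closed: "X \<in> Obj C \<Longrightarrow> idm C X \<in> arr C X X"
    and comp_closed:
      "\<lbrakk>X \<in> Obj C; Y \<in> Obj C; Z \<in> Obj C; f \<in> arr C X Y; g \<in> arr C Y Z\<rbrakk>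
        \<Longrightarrow> g \<bullet> f \<in> arr C X Z"
    and id_left:
      "\<lbrakk>X \<in> Obj C; Y \<in> Obj C; f \<in> arr C X Y\<rbrakk> \<Longrightarrow> idm C Y \<bullet> f = f"
    and id_right:
      "\<lbrakk>X \<in> Obj C; Y \<in> Obj C; f \<in> arr C X Y\<rbrakk> \<Longrightarrow> f \<bullet> idm C X = f"
    and comp_assoc:
      "\<lbrakk>W \<in> Obj C; X \<in> Obj C; Y \<in> Obj C; Z \<in> Obj C;
        f \<in> arr C W X; g \<in> arr C X Y; h \<in> arr C Y Z\<rbrakk>
        \<Longrightarrow> (h \<bullet> g) \<bullet> f = h \<bullet> (g \<bullet> f)"
    and comp_add_left:
      "\<lbrakk>X \<in> Obj C; Y \<in> Obj C; Z \<in> Obj C; f \<in> arr C X Y; g \<in> arr C Y Z; g' \<in> arr C Y Z\<rbrakk>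
        \<Longrightarrow> (g \<oplus>\<^bsub>Hom C Y Z\<^esub> g') \<bullet> f = (g \<bullet> f) \<oplus>\<^bsub>Hom C X Z\<^esub> (g' \<bullet> f)"
    and comp_add_right:
      "\<lbrakk>X \<in> Obj C; Y \<in> Obj C; Z \<in> Obj C; f \<in> arr C X Y; f' \<in> arr C X Y; g \<in> arr C Y Z\<rbrakk>
        \<Longrightarrow> g \<bullet> (f \<oplus>\<^bsub>Hom C X Y\<^esub> f') = (g \<bullet> f) \<oplus>\<^bsub>Hom C X Z\<^esub> (g \<bullet> f')"
    and comp_smult_left:
      "\<lbrakk>X \<in> Obj C; Y \<in> Obj C; Z \<in> Obj C; a \<in> carrier k; f \<in> arr C X Y; g \<in> arr C Y Z\<rbrakk>
        \<Longrightarrow> (a \<odot>\<^bsub>Hom C Y Z\<^esub> g) \<bullet> f = a \<odot>\<^bsub>Hom C X Z\<^esub> (g \<bullet> f)"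
    and comp_smult_right:
      "\<lbrakk>X \<in> Obj C; Y \<in> Obj C; Z \<in> Obj C; a \<in> carrier k; f \<in> arr C X Y; g \<in> arr C Y Z\<rbrakk>
        \<Longrightarrow> g \<bullet> (a \<odot>\<^bsub>Hom C X Y\<^esub> f) = a \<odot>\<^bsub>Hom C X Z\<^esub> (g \<bullet> f)"

definition is_iso :: "('k, 'o, 'm, 'z) lin_cat_scheme \<Rightarrow> 'o \<Rightarrow> 'o \<Rightarrow> 'm \<Rightarrow> bool" where
  "is_iso C X Y f \<longleftrightarrow> f \<in> arr C X Y \<and>
     (\<exists>g \<in> arr C Y X. g \<bullet>\<^bsub>C\<^esub> f = idm C X \<and> f \<bullet>\<^bsub>C\<^esub> g = idm C Y)"

definition isomorphic :: "('k, 'o, 'm, 'z) lin_cat_scheme \<Rightarrow> 'o \<Rightarrow> 'o \<Rightarrow> bool" where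
  "isomorphic C X Y \<longleftrightarrow> (\<exists>f. is_iso C X Y f)"

definition is_zero_obj :: "('k, 'o, 'm, 'z) lin_cat_scheme \<Rightarrow> 'o \<Rightarrow> bool" where
  "is_zero_obj C Z \<longleftrightarrow> Z \<in> Obj C \<and>
     (\<forall>X \<in> Obj C. arr C X Z = {\<zero>\<^bsub>Hom C X Z\<^esub>} \<and> arr C Z X = {\<zero>\<^bsub>Hom C Z X\<^esub>})"

text \<open>
  \<open>Z\<close> is a direct sum (biproduct) of the finite list \<open>Xs\<close>, with injections \<open>\<iota> i\<close> and
  projections \<open>\<pi> i\<close>. For the empty list the condition says that the identity of \<open>Z\<close> is zero,
  so \<open>Z\<close> is a zero object.
\<close>

definition is_direct_sum :: "('k, 'o, 'm, 'z) lin_cat_scheme \<Rightarrow> 'o list \<Rightarrow> 'o \<Rightarrow> bool" where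
  "is_direct_sum C Xs Z \<longleftrightarrow> set Xs \<subseteq> Obj C \<and> Z \<in> Obj C \<and>
     (\<exists>\<iota> \<pi>.
        (\<forall>i < length Xs. \<iota> i \<in> arr C (Xs ! i) Z \<and> \<pi> i \<in> arr C Z (Xs ! i)) \<and>
        (\<forall>i < length Xs. \<forall>j < length Xs.
           \<pi> i \<bullet>\<^bsub>C\<^esub> \<iota> j = (if i = j then idm C (Xs ! i) else \<zero>\<^bsub>Hom C (Xs ! j) (Xs ! i)\<^esub>)) \<and>
        (\<Oplus>\<^bsub>Hom C Z Z\<^esub> i \<in> {..<length Xs}. \<iota> i \<bullet>\<^bsub>C\<^esub> \<pi> i) = idm C Z)"

definition is_direct_summand :: "('k, 'o, 'm, 'z) lin_cat_scheme \<Rightarrow> 'o \<Rightarrow> 'o \<Rightarrow> bool" where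
  "is_direct_summand C Y X \<longleftrightarrow> (\<exists>Y'. is_direct_sum C [Y, Y'] X)"

locale additive_linear_category = linear_category +
  assumes direct_sums_exist: "set Xs \<subseteq> Obj C \<Longrightarrow> \<exists>Z. is_direct_sum C Xs Z"

definition hom_finite ::
    "('k, 'r) ring_scheme \<Rightarrow> ('k, 'o, 'm, 'z) lin_cat_scheme \<Rightarrow> bool" where
  "hom_finite k C \<longleftrightarrow> (\<forall>X \<in> Obj C. \<forall>Y \<in> Obj C. vectorspace.fin_dim k (Hom C X Y))"

definition End_ring :: "('k, 'o, 'm, 'z) lin_cat_scheme \<Rightarrow> 'o \<Rightarrow> 'm ring" where
  "End_ring C X =
     \<lparr>carrier = arr C X X, mult = (\<lambda>g f. g \<bullet>\<^bsub>C\<^esub> f), one = idm C X,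
      zero = \<zero>\<^bsub>Hom C X X\<^esub>, add = (\<lambda>f g. f \<oplus>\<^bsub>Hom C X X\<^esub> g)\<rparr>"

text \<open>Rings are not assumed commutative. The zero ring is not local, as its only element is a unit.\<close>

definition local_ring :: "('a, 'b) ring_scheme \<Rightarrow> bool" where
  "local_ring R \<longleftrightarrow> ring R \<and> ideal (carrier R - Units R) R"

definition krull_schmidt :: "('k, 'o, 'm, 'z) lin_cat_scheme \<Rightarrow> bool" where
  "krull_schmidt C \<longleftrightarrow>
     (\<forall>X \<in> Obj C. \<exists>Xs. is_direct_sum C Xs X \<and> (\<forall>Y \<in> set Xs. local_ring (End_ring C Y)))"


section \<open>Triangulated categories\<close>

text \<open>
  \<open>sh\<close> and \<open>shm\<close> are the actions of the shift functor \<open>[1]\<close> on objects and on morphisms, and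
  \<open>dtri C X Y Z f g h\<close> says that \<open>X \<rightarrow> Y \<rightarrow> Z \<rightarrow> X[1]\<close>, with the morphisms \<open>f\<close>, \<open>g\<close>, \<open>h\<close>,
  is a (distinguished) triangle.
\<close>

record ('k, 'o, 'm) tri_cat = "('k, 'o, 'm) lin_cat" +
  sh :: "'o \<Rightarrow> 'o"
  shm :: "'m \<Rightarrow> 'm"
  dtri :: "'o \<Rightarrow> 'o \<Rightarrow> 'o \<Rightarrow> 'm \<Rightarrow> 'm \<Rightarrow> 'm \<Rightarrow> bool"

text \<open>
  The shift is a \<open>k\<close>-linear autoequivalence (fully faithful and essentially surjective), which
  covers the convention that it be an automorphism of \<open>C\<close>.
\<close>

locale triangulated_category = additive_linear_category k C
  for k :: "('k, 'r) ring_scheme"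
    and C :: "('k, 'o, 'm, 'z) tri_cat_scheme" (structure) +
  assumes sh_closed: "X \<in> Obj C \<Longrightarrow> sh C X \<in> Obj C"
    and shm_bij:
      "\<lbrakk>X \<in> Obj C; Y \<in> Obj C\<rbrakk> \<Longrightarrow> bij_betw (shm C) (arr C X Y) (arr C (sh C X) (sh C Y))"
    and sh_ess_surj: "Y \<in> Obj C \<Longrightarrow> \<exists>X \<in> Obj C. isomorphic C (sh C X) Y"
    and shm_id: "X \<in> Obj C \<Longrightarrow> shm C (idm C X) = idm C (sh C X)"
    and shm_comp:
      "\<lbrakk>X \<in> Obj C; Y \<in> Obj C; Z \<in> Obj C; f \<in> arr C X Y; g \<in> arr C Y Z\<rbrakk>
        \<Longrightarrow> shm C (g \<bullet> f) = shm C g \<bullet> shm C f"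
    and shm_add:
      "\<lbrakk>X \<in> Obj C; Y \<in> Obj C; f \<in> arr C X Y; g \<in> arr C X Y\<rbrakk>
        \<Longrightarrow> shm C (f \<oplus>\<^bsub>Hom C X Y\<^esub> g) = shm C f \<oplus>\<^bsub>Hom C (sh C X) (sh C Y)\<^esub> shm C g"
    and shm_smult:
      "\<lbrakk>X \<in> Obj C; Y \<in> Obj C; s \<in> carrier k; f \<in> arr C X Y\<rbrakk>
        \<Longrightarrow> shm C (s \<odot>\<^bsub>Hom C X Y\<^esub> f) = s \<odot>\<^bsub>Hom C (sh C X) (sh C Y)\<^esub> shm C f"
    and dtri_closed:
      "dtri C X Y Z f g h \<Longrightarrow> X \<in> Obj C \<and> Y \<in> Obj C \<and> Z \<in> Obj C \<and>
         f \<in> arr C X Y \<and> g \<in> arr C Y Z \<and> h \<in> arr C Z (sh C X)"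
    and TR1_iso:
      "\<lbrakk>dtri C X Y Z f g h; X' \<in> Obj C; Y' \<in> Obj C; Z' \<in> Obj C;
        f' \<in> arr C X' Y'; g' \<in> arr C Y' Z'; h' \<in> arr C Z' (sh C X');
        is_iso C X X' a; is_iso C Y Y' b; is_iso C Z Z' c;
        b \<bullet> f = f' \<bullet> a; c \<bullet> g = g' \<bullet> b; shm C a \<bullet> h = h' \<bullet> c\<rbrakk>
        \<Longrightarrow> dtri C X' Y' Z' f' g' h'"
    and TR1_id:
      "\<lbrakk>X \<in> Obj C; is_zero_obj C Z\<rbrakk>
        \<Longrightarrow> dtri C X X Z (idm C X) \<zero>\<^bsub>Hom C X Z\<^esub> \<zero>\<^bsub>Hom C Z (sh C X)\<^esub>"
    and TR1_cone:
      "\<lbrakk>X \<in> Obj C; Y \<in> Obj C; f \<in> arr C X Y\<rbrakk> \<Longrightarrow> \<exists>Z g h. dtri C X Y Z f g h"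
    and TR2:
      "\<lbrakk>X \<in> Obj C; Y \<in> Obj C; Z \<in> Obj C;
        f \<in> arr C X Y; g \<in> arr C Y Z; h \<in> arr C Z (sh C X)\<rbrakk>
        \<Longrightarrow> dtri C X Y Z f g h \<longleftrightarrow>
            dtri C Y Z (sh C X) g h (\<ominus>\<^bsub>Hom C (sh C X) (sh C Y)\<^esub> shm C f)"
    and TR3:
      "\<lbrakk>dtri C X Y Z f g h; dtri C X' Y' Z' f' g' h';
        a \<in> arr C X X'; b \<in> arr C Y Y'; b \<bullet> f = f' \<bullet> a\<rbrakk>
        \<Longrightarrow> \<exists>c \<in> arr C Z Z'. c \<bullet> g = g' \<bullet> b \<and> shm C a \<bullet> h = h' \<bullet> c"
    and TR4:
      "\<lbrakk>dtri C X Y U f i p; dtri C Y Z W g j q; dtri C X Z V (g \<bullet> f) l r\<rbrakk>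
        \<Longrightarrow> \<exists>u v. dtri C U V W u v (shm C i \<bullet> q) \<and>
              u \<bullet> i = l \<bullet> g \<and> r \<bullet> u = p \<and> v \<bullet> l = j \<and> q \<bullet> v = shm C f \<bullet> r"

text \<open>Full subcategories are given by their sets of objects.\<close>

definition closed_subcategory ::
    "('k, 'o, 'm, 'z) lin_cat_scheme \<Rightarrow> 'o set \<Rightarrow> bool" where
  "closed_subcategory C T \<longleftrightarrow> T \<subseteq> Obj C \<and>
     (\<forall>X \<in> T. \<forall>Y \<in> Obj C. isomorphic C X Y \<longrightarrow> Y \<in> T) \<and>
     (\<forall>Xs Z. set Xs \<subseteq> T \<and> is_direct_sum C Xs Z \<longrightarrow> Z \<in> T) \<and>
     (\<forall>X \<in> T. \<forall>Y. is_direct_summand C Y X \<longrightarrow> Y \<in> T)"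

definition shift_subcat :: "('k, 'o, 'm, 'z) tri_cat_scheme \<Rightarrow> 'o set \<Rightarrow> 'o set" where
  "shift_subcat C T = {Y \<in> Obj C. \<exists>X \<in> T. isomorphic C Y (sh C X)}"

definition star :: "('k, 'o, 'm, 'z) tri_cat_scheme \<Rightarrow> 'o set \<Rightarrow> 'o set \<Rightarrow> 'o set" where
  "star C A B = {Z \<in> Obj C. \<exists>X \<in> A. \<exists>Y \<in> B. \<exists>f g h. dtri C X Z Y f g h}"

definition rigid :: "('k, 'o, 'm, 'z) tri_cat_scheme \<Rightarrow> 'o set \<Rightarrow> bool" where
  "rigid C T \<longleftrightarrow>
     (\<forall>X \<in> T. \<forall>Y \<in> T. arr C X (sh C Y) = {\<zero>\<^bsub>Hom C X (sh C Y)\<^esub>})"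

definition right_approximation ::
    "('k, 'o, 'm, 'z) lin_cat_scheme \<Rightarrow> 'o set \<Rightarrow> 'o \<Rightarrow> 'o \<Rightarrow> 'm \<Rightarrow> bool" where
  "right_approximation C T S X f \<longleftrightarrow> S \<in> T \<and> f \<in> arr C S X \<and>
     (\<forall>S' \<in> T. \<forall>g \<in> arr C S' X. \<exists>h \<in> arr C S' S. g = f \<bullet>\<^bsub>C\<^esub> h)"

definition contravariantly_finite ::
    "('k, 'o, 'm, 'z) lin_cat_scheme \<Rightarrow> 'o set \<Rightarrow> bool" where
  "contravariantly_finite C T \<longleftrightarrow> (\<forall>X \<in> Obj C. \<exists>S f. right_approximation C T S X f)"

definition factor_ideal ::
    "('k, 'o, 'm, 'z) lin_cat_scheme \<Rightarrow> 'o \<Rightarrow> 'o \<Rightarrow> 'o \<Rightarrow> 'm set" where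
  "factor_ideal C X A B = {f \<in> arr C A B. \<exists>a \<in> arr C A X. \<exists>b \<in> arr C X B. f = b \<bullet>\<^bsub>C\<^esub> a}"

definition factor_ideal_zero ::
    "('k, 'o, 'm, 'z) lin_cat_scheme \<Rightarrow> 'o \<Rightarrow> 'o set \<Rightarrow> bool" where
  "factor_ideal_zero C X S \<longleftrightarrow>
     (\<forall>A \<in> S. \<forall>B \<in> S. factor_ideal C X A B = {\<zero>\<^bsub>Hom C A B\<^esub>})"


section \<open>Finitely presented functors\<close>

text \<open>
  Contravariant functors from a full subcategory \<open>T\<close> to abelian groups. Values are abelian groups
  in the (multiplicative) sense of \<^locale>\<open>comm_group\<close>. Only the values on objects and morphisms of
  \<open>T\<close> are constrained, and only these matter below.
\<close>

record ('o, 'm, 'v) cfunctor =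
  fobj :: "'o \<Rightarrow> 'v monoid"
  fmap :: "'m \<Rightarrow> 'v \<Rightarrow> 'v"

definition additive_cfunctor ::
    "('k, 'o, 'm, 'z) lin_cat_scheme \<Rightarrow> 'o set \<Rightarrow> ('o, 'm, 'v) cfunctor \<Rightarrow> bool" where
  "additive_cfunctor C T F \<longleftrightarrow>
     (\<forall>X \<in> T. comm_group (fobj F X)) \<and>
     (\<forall>X \<in> T. \<forall>Y \<in> T. \<forall>f \<in> arr C X Y. fmap F f \<in> hom (fobj F Y) (fobj F X)) \<and>
     (\<forall>X \<in> T. \<forall>x \<in> carrier (fobj F X). fmap F (idm C X) x = x) \<and>
     (\<forall>X \<in> T. \<forall>Y \<in> T. \<forall>Z \<in> T. \<forall>f \<in> arr C X Y. \<forall>g \<in> arr C Y Z. \<forall>x \<in> carrier (fobj F Z).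
        fmap F (g \<bullet>\<^bsub>C\<^esub> f) x = fmap F f (fmap F g x)) \<and>
     (\<forall>X \<in> T. \<forall>Y \<in> T. \<forall>f \<in> arr C X Y. \<forall>g \<in> arr C X Y. \<forall>x \<in> carrier (fobj F Y).
        fmap F (f \<oplus>\<^bsub>Hom C X Y\<^esub> g) x = fmap F f x \<otimes>\<^bsub>fobj F X\<^esub> fmap F g x)"

definition nat_trans ::
    "('k, 'o, 'm, 'z) lin_cat_scheme \<Rightarrow> 'o set \<Rightarrow> ('o, 'm, 'v) cfunctor
      \<Rightarrow> ('o, 'm, 'w) cfunctor \<Rightarrow> ('o \<Rightarrow> 'v \<Rightarrow> 'w) \<Rightarrow> bool" where
  "nat_trans C T F G \<eta> \<longleftrightarrow>
     (\<forall>X \<in> T. \<eta> X \<in> hom (fobj F X) (fobj G X)) \<and>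
     (\<forall>X \<in> T. \<forall>Y \<in> T. \<forall>f \<in> arr C X Y. \<forall>x \<in> carrier (fobj F Y).
        \<eta> X (fmap F f x) = fmap G f (\<eta> Y x))"

text \<open>Exactness of \<open>F \<rightarrow> G \<rightarrow> H\<close> at \<open>G\<close>, and surjectivity, are pointwise.\<close>

definition exact_at ::
    "'o set \<Rightarrow> ('o, 'm, 'u) cfunctor \<Rightarrow> ('o, 'm, 'v) cfunctor \<Rightarrow> ('o, 'm, 'w) cfunctor
      \<Rightarrow> ('o \<Rightarrow> 'u \<Rightarrow> 'v) \<Rightarrow> ('o \<Rightarrow> 'v \<Rightarrow> 'w) \<Rightarrow> bool" where
  "exact_at T F G H \<alpha> \<beta> \<longleftrightarrow>
     (\<forall>X \<in> T. \<alpha> X ` carrier (fobj F X) = kernel (fobj G X) (fobj H X) (\<beta> X))"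

definition epi ::
    "'o set \<Rightarrow> ('o, 'm, 'v) cfunctor \<Rightarrow> ('o, 'm, 'w) cfunctor \<Rightarrow> ('o \<Rightarrow> 'v \<Rightarrow> 'w) \<Rightarrow> bool" where
  "epi T F G \<eta> \<longleftrightarrow> (\<forall>X \<in> T. \<eta> X ` carrier (fobj F X) = carrier (fobj G X))"

text \<open>The functor \<open>Hom(-, X)\<close>; its restriction to \<open>T\<close> is \<open>\<H> X\<close>.\<close>

definition Hfun :: "('k, 'o, 'm, 'z) lin_cat_scheme \<Rightarrow> 'o \<Rightarrow> ('o, 'm, 'm) cfunctor" where
  "Hfun C X =
     \<lparr>fobj = (\<lambda>S. \<lparr>carrier = arr C S X, mult = (\<lambda>f g. f \<oplus>\<^bsub>Hom C S X\<^esub> g), one = \<zero>\<^bsub>Hom C S X\<^esub>\<rparr>),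
      fmap = (\<lambda>f g. g \<bullet>\<^bsub>C\<^esub> f)\<rparr>"

definition finitely_presented ::
    "('k, 'o, 'm, 'z) lin_cat_scheme \<Rightarrow> 'o set \<Rightarrow> ('o, 'm, 'v) cfunctor \<Rightarrow> bool" where
  "finitely_presented C T F \<longleftrightarrow>
     (\<exists>T1 \<in> T. \<exists>T0 \<in> T. \<exists>\<alpha> \<beta>.
        nat_trans C T (Hfun C T1) (Hfun C T0) \<alpha> \<and> nat_trans C T (Hfun C T0) F \<beta> \<and>
        exact_at T (Hfun C T1) (Hfun C T0) F \<alpha> \<beta> \<and> epi T (Hfun C T0) F \<beta>)"

text \<open>
  The objects of \<open>mod T\<close>; its morphisms are all natural transformations. The groups \<open>F(X)\<close> are
  taken with carriers in the type \<open>'m\<close> of morphisms of \<open>C\<close>. Up to isomorphism this is no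
  restriction: a finitely presented functor has values which are quotients of groups \<open>Hom(X, T0)\<close>,
  so by choosing representatives of cosets it is isomorphic to one of this form.
\<close>

definition mod_cat ::
    "('k, 'o, 'm, 'z) lin_cat_scheme \<Rightarrow> 'o set \<Rightarrow> ('o, 'm, 'm) cfunctor set" where
  "mod_cat C T = {F. additive_cfunctor C T F \<and> finitely_presented C T F}"

definition projective ::
    "('k, 'o, 'm, 'z) lin_cat_scheme \<Rightarrow> 'o set \<Rightarrow> ('o, 'm, 'm) cfunctor \<Rightarrow> bool" where
  "projective C T P \<longleftrightarrow> P \<in> mod_cat C T \<and>
     (\<forall>E \<in> mod_cat C T. \<forall>F \<in> mod_cat C T. \<forall>\<pi> \<phi>.
        nat_trans C T E F \<pi> \<and> epi T E F \<pi> \<and> nat_trans C T P F \<phi> \<longrightarrow>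
        (\<exists>\<psi>. nat_trans C T P E \<psi> \<and>
             (\<forall>X \<in> T. \<forall>x \<in> carrier (fobj P X). \<pi> X (\<psi> X x) = \<phi> X x)))"

text \<open>
  A projective resolution \<open>\<dots> \<rightarrow> P 2 \<rightarrow> P 1 \<rightarrow> P 0 \<rightarrow> F \<rightarrow> 0\<close> in \<open>mod T\<close>, with differentials
  \<open>d n : P (n + 1) \<rightarrow> P n\<close> and augmentation \<open>\<epsilon> : P 0 \<rightarrow> F\<close>. It has length at most \<open>n\<close>
  if \<open>P i = 0\<close> for all \<open>i > n\<close>. The projective dimension is the infimum of the lengths, which is
  \<open>\<infinity>\<close> if there is no resolution of finite length.
\<close>

definition proj_resolution ::
    "('k, 'o, 'm, 'z) lin_cat_scheme \<Rightarrow> 'o set \<Rightarrow> ('o, 'm, 'm) cfunctor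
      \<Rightarrow> (nat \<Rightarrow> ('o, 'm, 'm) cfunctor) \<Rightarrow> (nat \<Rightarrow> 'o \<Rightarrow> 'm \<Rightarrow> 'm) \<Rightarrow> ('o \<Rightarrow> 'm \<Rightarrow> 'm) \<Rightarrow> bool" where
  "proj_resolution C T F P d \<epsilon> \<longleftrightarrow>
     (\<forall>i. projective C T (P i)) \<and>
     (\<forall>i. nat_trans C T (P (Suc i)) (P i) (d i)) \<and>
     nat_trans C T (P 0) F \<epsilon> \<and> epi T (P 0) F \<epsilon> \<and>
     exact_at T (P 1) (P 0) F (d 0) \<epsilon> \<and>
     (\<forall>i. exact_at T (P (Suc (Suc i))) (P (Suc i)) (P i) (d (Suc i)) (d i))"

definition is_zero_cfunctor :: "'o set \<Rightarrow> ('o, 'm, 'v) cfunctor \<Rightarrow> bool" where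
  "is_zero_cfunctor T F \<longleftrightarrow> (\<forall>X \<in> T. carrier (fobj F X) = {\<one>\<^bsub>fobj F X\<^esub>})"

definition proj_dim ::
    "('k, 'o, 'm, 'z) lin_cat_scheme \<Rightarrow> 'o set \<Rightarrow> ('o, 'm, 'm) cfunctor \<Rightarrow> enat" where
  "proj_dim C T F = Inf {enat n | n.
     \<exists>P d \<epsilon>. proj_resolution C T F P d \<epsilon> \<and> (\<forall>i > n. is_zero_cfunctor T (P i))}"

end

theory Submission
  imports Defs
begin

text \<open>
  Let \<open>T1 \<rightarrow> T0 \<rightarrow> X \<rightarrow> T1[1]\<close> be a triangle with \<open>T0\<close>, \<open>T1\<close> in \<open>T\<close> and first morphism \<open>f\<close>. Rigidity makes
  \<open>\<H> T1 \<rightarrow> \<H> T0 \<rightarrow> \<H> X \<rightarrow> 0\<close> exact, and every morphism from \<open>X\<close> to an object of \<open>T[1]\<close> factors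
  through \<open>X \<rightarrow> T1[1]\<close>; hence the ideal vanishes if and only if \<open>\<H> f\<close> is mono. If \<open>\<H> f\<close> is mono,
  the presentation is a projective resolution of length 1. Conversely, if \<open>pd \<H> X \<le> 1\<close>, comparing
  the presentation with a resolution of length 1 gives an idempotent \<open>e\<close> of \<open>T1\<close> that projects onto
  the kernel of \<open>\<H> f\<close>. As \<open>f e = 0\<close>, the idempotent \<open>e[1]\<close> factors through \<open>X\<close>. Since no
  indecomposable summand of \<open>X\<close> lies in \<open>T[1]\<close>, all morphisms from \<open>X\<close> to \<open>T[1]\<close> are radical, and a
  radical idempotent is zero. No idempotent has to be split for this.
\<close>

section \<open>Calculus in linear categories\<close>

context linear_category
begin

text \<open>Membership of both endpoints is bundled with membership of the arrow, so that later
  facts chain by \<open>OF\<close> without separate side conditions on objects.\<close>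

definition mor :: "'m \<Rightarrow> 'o \<Rightarrow> 'o \<Rightarrow> bool" where
  "mor f X Y \<longleftrightarrow> X \<in> Obj C \<and> Y \<in> Obj C \<and> f \<in> arr C X Y"

abbreviation zero_mor :: "'o \<Rightarrow> 'o \<Rightarrow> 'm" where
  "zero_mor X Y \<equiv> \<zero>\<^bsub>Hom C X Y\<^esub>"

abbreviation plus_mor :: "'o \<Rightarrow> 'o \<Rightarrow> 'm \<Rightarrow> 'm \<Rightarrow> 'm" where
  "plus_mor X Y f g \<equiv> f \<oplus>\<^bsub>Hom C X Y\<^esub> g"

abbreviation minus_mor :: "'o \<Rightarrow> 'o \<Rightarrow> 'm \<Rightarrow> 'm \<Rightarrow> 'm" where
  "minus_mor X Y f g \<equiv> f \<ominus>\<^bsub>Hom C X Y\<^esub> g"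

lemma morI: "X \<in> Obj C \<Longrightarrow> Y \<in> Obj C \<Longrightarrow> f \<in> arr C X Y \<Longrightarrow> mor f X Y"
  by (simp add: mor_def)

lemma morD:
  assumes "mor f X Y"
  shows "X \<in> Obj C" "Y \<in> Obj C" "f \<in> arr C X Y"
  using assms by (simp_all add: mor_def)

lemma abelian_group_Hom: "X \<in> Obj C \<Longrightarrow> Y \<in> Obj C \<Longrightarrow> abelian_group (Hom C X Y)"
  using hom_vectorspace unfolding vectorspace_def module_def by blast

lemma mor_id: "X \<in> Obj C \<Longrightarrow> mor (idm C X) X X"
  by (simp add: mor_def id_closed)

lemma mor_comp: "mor f X Y \<Longrightarrow> mor g Y Z \<Longrightarrow> mor (g \<bullet> f) X Z"
  unfolding mor_def using comp_closed by blast

lemma mor_zero: "X \<in> Obj C \<Longrightarrow> Y \<in> Obj C \<Longrightarrow> mor (zero_mor X Y) X Y"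
  by (simp add: mor_def abelian_group.axioms(1) abelian_group_Hom abelian_monoid.zero_closed)

lemma mor_plus: "mor f X Y \<Longrightarrow> mor g X Y \<Longrightarrow> mor (plus_mor X Y f g) X Y"
  unfolding mor_def by (meson abelian_group.axioms(1) abelian_group_Hom abelian_monoid.a_closed)

lemma mor_minus: "mor f X Y \<Longrightarrow> mor g X Y \<Longrightarrow> mor (minus_mor X Y f g) X Y"
  unfolding mor_def by (meson abelian_group.minus_closed abelian_group_Hom)

lemma mor_uminus: "mor f X Y \<Longrightarrow> mor (\<ominus>\<^bsub>Hom C X Y\<^esub> f) X Y"
  unfolding mor_def by (meson abelian_group.a_inv_closed abelian_group_Hom)

lemma assoc_mor: "mor f W X \<Longrightarrow> mor g X Y \<Longrightarrow> mor h Y Z \<Longrightarrow> (h \<bullet> g) \<bullet> f = h \<bullet> (g \<bullet> f)"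
  unfolding mor_def using comp_assoc by blast

lemma id_left_mor: "mor f X Y \<Longrightarrow> idm C Y \<bullet> f = f"
  unfolding mor_def using id_left by blast

lemma id_right_mor: "mor f X Y \<Longrightarrow> f \<bullet> idm C X = f"
  unfolding mor_def using id_right by blast

lemma plus_comp:
  "mor f X Y \<Longrightarrow> mor g Y Z \<Longrightarrow> mor g' Y Z \<Longrightarrow>
    plus_mor Y Z g g' \<bullet> f = plus_mor X Z (g \<bullet> f) (g' \<bullet> f)"
  unfolding mor_def using comp_add_left by blast

lemma comp_plus:
  "mor f X Y \<Longrightarrow> mor f' X Y \<Longrightarrow> mor g Y Z \<Longrightarrow>
    g \<bullet> plus_mor X Y f f' = plus_mor X Z (g \<bullet> f) (g \<bullet> f')"
  unfolding mor_def using comp_add_right by blast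

lemma plus_zero_mor:
  assumes "mor f X Y"
  shows "plus_mor X Y f (zero_mor X Y) = f" "plus_mor X Y (zero_mor X Y) f = f"
proof -
  interpret abelian_group "Hom C X Y" using assms abelian_group_Hom morD by blast
  show "plus_mor X Y f (zero_mor X Y) = f" "plus_mor X Y (zero_mor X Y) f = f"
    using assms by (simp_all add: mor_def)
qed

text \<open>Bilinearity of composition and additivity of the shift are axioms about sums only.
  Preservation of zero follows by cancelling in \<open>0 + 0 = 0\<close>, and this is the
  cancellation.\<close>

lemma idem_plus_zero:
  assumes "mor f X Y" "plus_mor X Y f f = f"
  shows "f = zero_mor X Y"
proof -
  interpret abelian_group "Hom C X Y" using assms abelian_group_Hom morD by blast
  show ?thesis using assms add.l_cancel_one'[of f f] morD(3)[OF assms(1)] by auto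
qed

lemma zero_comp: "mor f X Y \<Longrightarrow> Z \<in> Obj C \<Longrightarrow> zero_mor Y Z \<bullet> f = zero_mor X Z"
proof -
  assume f: "mor f X Y" and Z: "Z \<in> Obj C"
  have z: "mor (zero_mor Y Z) Y Z" using f Z by (simp add: mor_zero morD)
  from plus_comp[OF f z z] show ?thesis
    by (intro idem_plus_zero mor_comp[OF f z]) (simp add: plus_zero_mor[OF z])
qed

lemma comp_zero: "mor f X Y \<Longrightarrow> W \<in> Obj C \<Longrightarrow> f \<bullet> zero_mor W X = zero_mor W Y"
proof -
  assume f: "mor f X Y" and W: "W \<in> Obj C"
  have z: "mor (zero_mor W X) W X" using f W by (simp add: mor_zero morD)
  from comp_plus[OF z z f] show ?thesis
    by (intro idem_plus_zero mor_comp[OF z f]) (simp add: plus_zero_mor[OF z])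
qed

text \<open>Characterising a difference by a sum reduces the laws for composing differences to the
  distributivity axioms.\<close>

lemma minus_mor_eq_iff:
  assumes "mor f X Y" "mor g X Y" "mor h X Y"
  shows "minus_mor X Y f g = h \<longleftrightarrow> f = plus_mor X Y h g"
proof -
  interpret abelian_group "Hom C X Y" using assms abelian_group_Hom morD by blast
  have "minus_mor X Y (plus_mor X Y h g) g = h"
    using assms[THEN morD(3)] by (simp add: minus_eq a_assoc r_neg)
  moreover have "plus_mor X Y (minus_mor X Y f g) g = f"
    using assms[THEN morD(3)] by (simp add: minus_eq a_assoc l_neg)
  ultimately show ?thesis by auto
qed

lemma minus_plus_mor:
  assumes "mor f X Y" "mor g X Y"
  shows "plus_mor X Y (minus_mor X Y f g) g = f"
  using minus_mor_eq_iff[OF assms mor_minus[OF assms]] by simp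

lemma minus_comp:
  assumes "mor f X Y" "mor g Y Z" "mor g' Y Z"
  shows "minus_mor Y Z g g' \<bullet> f = minus_mor X Z (g \<bullet> f) (g' \<bullet> f)"
proof -
  have m: "mor (minus_mor Y Z g g') Y Z"
    using assms by (simp add: mor_minus)
  have "g \<bullet> f = plus_mor X Z (minus_mor Y Z g g' \<bullet> f) (g' \<bullet> f)"
    using plus_comp[OF assms(1) m assms(3)] minus_plus_mor[OF assms(2,3)] by simp
  then show ?thesis
    using minus_mor_eq_iff[OF mor_comp[OF assms(1,2)] mor_comp[OF assms(1,3)] mor_comp[OF assms(1) m]]
    by simp
qed

lemma comp_minus:
  assumes "mor f X Y" "mor f' X Y" "mor g Y Z"
  shows "g \<bullet> minus_mor X Y f f' = minus_mor X Z (g \<bullet> f) (g \<bullet> f')"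
proof -
  have m: "mor (minus_mor X Y f f') X Y"
    using assms by (simp add: mor_minus)
  have "g \<bullet> f = plus_mor X Z (g \<bullet> minus_mor X Y f f') (g \<bullet> f')"
    using comp_plus[OF m assms(2,3)] minus_plus_mor[OF assms(1,2)] by simp
  then show ?thesis
    using minus_mor_eq_iff[OF mor_comp[OF assms(1,3)] mor_comp[OF assms(2,3)] mor_comp[OF m assms(3)]]
    by simp
qed

lemma minus_mor_self: "mor f X Y \<Longrightarrow> minus_mor X Y f f = zero_mor X Y"
  by (simp add: minus_mor_eq_iff mor_zero morD plus_zero_mor(2))

lemma minus_mor_zero: "mor f X Y \<Longrightarrow> minus_mor X Y f (zero_mor X Y) = f"
  by (simp add: minus_mor_eq_iff mor_zero morD plus_zero_mor(1))

lemma minus_mor_eq_zero: "mor f X Y \<Longrightarrow> mor g X Y \<Longrightarrow> minus_mor X Y f g = zero_mor X Y \<longleftrightarrow> f = g"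
  by (simp add: minus_mor_eq_iff mor_zero morD plus_zero_mor(2))

lemma minus_minus_mor:
  assumes "mor f X Y" "mor g X Y" "mor h X Y"
  shows "minus_mor X Y (minus_mor X Y f g) h = minus_mor X Y f (plus_mor X Y g h)"
proof -
  interpret abelian_group "Hom C X Y" using assms abelian_group_Hom morD by blast
  show ?thesis using assms[THEN morD(3)] by (simp add: minus_eq a_assoc minus_add)
qed

lemma uminus_comp:
  assumes "mor f X Y" "mor g Y Z"
  shows "(\<ominus>\<^bsub>Hom C Y Z\<^esub> g) \<bullet> f = \<ominus>\<^bsub>Hom C X Z\<^esub> (g \<bullet> f)"
proof -
  interpret Y: abelian_group "Hom C Y Z" using assms abelian_group_Hom morD by blast
  interpret X: abelian_group "Hom C X Z" using assms abelian_group_Hom morD by blast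
  have "minus_mor Y Z (zero_mor Y Z) g \<bullet> f = minus_mor X Z (zero_mor X Z) (g \<bullet> f)"
    using minus_comp[OF assms(1) mor_zero assms(2)] zero_comp[OF assms(1)] assms by (simp add: morD)
  then show ?thesis
    using assms[THEN morD(3)] mor_comp[OF assms, THEN morD(3)] by (simp add: X.minus_eq Y.minus_eq)
qed

lemma comp_uminus:
  assumes "mor f X Y" "mor g Y Z"
  shows "g \<bullet> (\<ominus>\<^bsub>Hom C X Y\<^esub> f) = \<ominus>\<^bsub>Hom C X Z\<^esub> (g \<bullet> f)"
proof -
  interpret Y: abelian_group "Hom C X Y" using assms abelian_group_Hom morD by blast
  interpret X: abelian_group "Hom C X Z" using assms abelian_group_Hom morD by blast
  have "g \<bullet> minus_mor X Y (zero_mor X Y) f = minus_mor X Z (zero_mor X Z) (g \<bullet> f)"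
    using comp_minus[OF mor_zero assms(1,2)] comp_zero[OF assms(2)] assms by (simp add: morD)
  then show ?thesis
    using assms[THEN morD(3)] mor_comp[OF assms, THEN morD(3)] by (simp add: X.minus_eq Y.minus_eq)
qed

lemma uminus_mor_eq_zero:
  assumes "mor f X Y"
  shows "\<ominus>\<^bsub>Hom C X Y\<^esub> f = zero_mor X Y \<longleftrightarrow> f = zero_mor X Y"
proof -
  interpret abelian_group "Hom C X Y" using assms abelian_group_Hom morD by blast
  show ?thesis using minus_minus[OF morD(3)[OF assms]] minus_zero by auto
qed

lemma uminus_uminus_mor: "mor f X Y \<Longrightarrow> \<ominus>\<^bsub>Hom C X Y\<^esub> (\<ominus>\<^bsub>Hom C X Y\<^esub> f) = f"
  by (simp add: abelian_group.minus_minus abelian_group_Hom mor_def)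

lemma uminus_mor_inj:
  assumes "\<ominus>\<^bsub>Hom C X Y\<^esub> f = \<ominus>\<^bsub>Hom C X Y\<^esub> g" "mor f X Y" "mor g X Y"
  shows "f = g"
  using arg_cong[OF assms(1), of "a_inv (Hom C X Y)"]
  unfolding uminus_uminus_mor[OF assms(2)] uminus_uminus_mor[OF assms(3)] .

section \<open>Isomorphisms, zero objects and binary biproducts\<close>

lemma is_isoE:
  assumes "is_iso C X Y f" "X \<in> Obj C" "Y \<in> Obj C"
  obtains g where "mor f X Y" "mor g Y X" "g \<bullet> f = idm C X" "f \<bullet> g = idm C Y"
  using assms unfolding is_iso_def mor_def by blast

lemma is_isoI:
  "mor f X Y \<Longrightarrow> mor g Y X \<Longrightarrow> g \<bullet> f = idm C X \<Longrightarrow> f \<bullet> g = idm C Y \<Longrightarrow> is_iso C X Y f"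
  unfolding is_iso_def mor_def by blast

lemma is_iso_id: "X \<in> Obj C \<Longrightarrow> is_iso C X X (idm C X)"
  by (rule is_isoI[of _ _ _ "idm C X"]) (simp_all add: mor_id id_left id_closed)

lemma zero_obj_mor:
  assumes "is_zero_obj C Z" "mor f X Y" "X = Z \<or> Y = Z"
  shows "f = zero_mor X Y"
  using assms unfolding is_zero_obj_def mor_def by blast

text \<open>Every morphism into or out of \<open>Z\<close> absorbs the identity of \<open>Z\<close>,
  so it vanishes as soon as that identity does.\<close>

lemma is_zero_objI:
  assumes "Z \<in> Obj C" "idm C Z = zero_mor Z Z"
  shows "is_zero_obj C Z"
proof -
  have *: "f = zero_mor X Z" if "mor f X Z" for X f
    using id_left_mor[OF that] zero_comp[OF that assms(1)] assms(2) by simp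
  have **: "f = zero_mor Z X" if "mor f Z X" for X f
    using id_right_mor[OF that] comp_zero[OF that assms(1)] assms(2) by simp
  show ?thesis
    unfolding is_zero_obj_def
    using * ** mor_zero assms(1) by (auto simp: mor_def)
qed

lemma empty_direct_sum_zero:
  assumes "is_direct_sum C [] Z"
  shows "is_zero_obj C Z"
proof -
  have Z: "Z \<in> Obj C" using assms unfolding is_direct_sum_def by blast
  interpret abelian_group "Hom C Z Z" using Z abelian_group_Hom by blast
  have "idm C Z = zero_mor Z Z" using assms unfolding is_direct_sum_def by auto
  then show ?thesis using Z is_zero_objI by blast
qed

lemma is_direct_sum_pairI:
  assumes "mor i A Z" "mor p Z A" "mor j B Z" "mor q Z B"
    and "p \<bullet> i = idm C A" "q \<bullet> j = idm C B" "p \<bullet> j = zero_mor B A" "q \<bullet> i = zero_mor A B"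
    and "plus_mor Z Z (i \<bullet> p) (j \<bullet> q) = idm C Z"
  shows "is_direct_sum C [A, B] Z"
proof -
  interpret abelian_group "Hom C Z Z" using assms abelian_group_Hom morD by blast
  \<comment> \<open>Only the indices 0 and 1 are ever evaluated; every other index is sent to the
    second pair of maps by default.\<close>
  define \<iota> where "\<iota> n = (if n = (0::nat) then i else j)" for n
  define \<pi> where "\<pi> n = (if n = (0::nat) then p else q)" for n
  have closed: "j \<bullet> q \<in> arr C Z Z" "i \<bullet> p \<in> arr C Z Z"
    using assms mor_comp morD(3) by blast+
  have "(\<Oplus>\<^bsub>Hom C Z Z\<^esub> n \<in> {..<2::nat}. \<iota> n \<bullet> \<pi> n) = plus_mor Z Z (i \<bullet> p) (j \<bullet> q)"
  proof -
    have "{..<2::nat} = {0, 1}" by auto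
    then show ?thesis
      using closed by (simp add: \<iota>_def \<pi>_def a_comm)
  qed
  then have "(\<Oplus>\<^bsub>Hom C Z Z\<^esub> n \<in> {..<length [A, B]}. \<iota> n \<bullet> \<pi> n) = idm C Z"
    using assms(9) by (simp add: numeral_2_eq_2)
  moreover have "\<forall>n < length [A, B]. \<iota> n \<in> arr C ([A, B] ! n) Z \<and> \<pi> n \<in> arr C Z ([A, B] ! n)"
    using assms by (auto simp: \<iota>_def \<pi>_def less_Suc_eq mor_def)
  moreover have "\<forall>n < length [A, B]. \<forall>m < length [A, B].
      \<pi> n \<bullet> \<iota> m = (if n = m then idm C ([A, B] ! n) else zero_mor ([A, B] ! m) ([A, B] ! n))"
    using assms by (auto simp: \<iota>_def \<pi>_def less_Suc_eq)
  moreover have "set [A, B] \<subseteq> Obj C" "Z \<in> Obj C"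
    using morD(1)[OF assms(1)] morD(1)[OF assms(3)] morD(2)[OF assms(1)] by simp_all
  ultimately show ?thesis
    unfolding is_direct_sum_def by blast
qed

end

context additive_linear_category
begin

lemma zero_obj_exists: "\<exists>Z. is_zero_obj C Z"
  using direct_sums_exist[of "[]"] empty_direct_sum_zero by auto

end

section \<open>Triangles\<close>

context triangulated_category
begin

lemma mor_shm: "mor f X Y \<Longrightarrow> mor (shm C f) (sh C X) (sh C Y)"
  using shm_bij[of X Y] sh_closed[of X] sh_closed[of Y] by (auto simp: mor_def bij_betw_def)

lemma shm_inj: "mor f X Y \<Longrightarrow> mor g X Y \<Longrightarrow> shm C f = shm C g \<Longrightarrow> f = g"
  by (rule inj_onD[OF bij_betw_imp_inj_on[OF shm_bij[of X Y]]]) (simp_all add: mor_def)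

lemma shm_surj:
  assumes "mor g (sh C X) (sh C Y)" "X \<in> Obj C" "Y \<in> Obj C"
  obtains f where "mor f X Y" "shm C f = g"
proof -
  have "g \<in> shm C ` arr C X Y"
    using shm_bij[OF assms(2,3)] morD(3)[OF assms(1)] by (simp add: bij_betw_def)
  then show thesis using that assms(2,3) by (auto simp: mor_def)
qed

lemma shm_comp_mor: "mor f X Y \<Longrightarrow> mor g Y Z \<Longrightarrow> shm C (g \<bullet> f) = shm C g \<bullet> shm C f"
  using shm_comp[of X Y Z f g] by (simp add: mor_def)

lemma shm_zero:
  assumes "X \<in> Obj C" "Y \<in> Obj C"
  shows "shm C (zero_mor X Y) = zero_mor (sh C X) (sh C Y)"
proof (rule idem_plus_zero)
  show "mor (shm C (zero_mor X Y)) (sh C X) (sh C Y)"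
    using assms mor_zero mor_shm by blast
  show "plus_mor (sh C X) (sh C Y) (shm C (zero_mor X Y)) (shm C (zero_mor X Y)) = shm C (zero_mor X Y)"
    using shm_add[OF assms morD(3)[OF mor_zero[OF assms]] morD(3)[OF mor_zero[OF assms]]]
      plus_zero_mor(1)[OF mor_zero[OF assms]] by simp
qed

lemma shm_eq_zero: "mor f X Y \<Longrightarrow> shm C f = zero_mor (sh C X) (sh C Y) \<Longrightarrow> f = zero_mor X Y"
  using shm_inj[of f X Y "zero_mor X Y"] shm_zero[of X Y] mor_zero[of X Y] by (simp add: morD)

lemma dtri_mor:
  assumes "dtri C X Y Z f g h"
  shows "mor f X Y" "mor g Y Z" "mor h Z (sh C X)"
  using dtri_closed[OF assms] sh_closed by (auto simp: mor_def)

section \<open>Exactness of the Hom functors on triangles\<close>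

lemma dtri_rotate:
  assumes "dtri C X Y Z f g h"
  shows "dtri C Y Z (sh C X) g h (\<ominus>\<^bsub>Hom C (sh C X) (sh C Y)\<^esub> shm C f)"
  using TR2 dtri_closed[OF assms] assms by blast

text \<open>TR3 maps the trivial triangle \<open>X \<rightarrow> X \<rightarrow> N\<close> with
  \<open>N\<close> zero to the given one, by the identity of \<open>X\<close> and by
  \<open>f\<close>. The resulting square exhibits \<open>g \<bullet> f\<close> as a map through
  \<open>N\<close>.\<close>

lemma dtri_comp_zero:
  assumes "dtri C X Y Z f g h"
  shows "g \<bullet> f = zero_mor X Z"
proof -
  note m = dtri_mor[OF assms]
  obtain N where N: "is_zero_obj C N" using zero_obj_exists by blast
  then have Oo: "N \<in> Obj C" by (simp add: is_zero_obj_def)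
  obtain c where c: "c \<in> arr C N Z" "c \<bullet> zero_mor X N = g \<bullet> f"
    using TR3[OF TR1_id[OF morD(1)[OF m(1)] N] assms id_closed[OF morD(1)[OF m(1)]] morD(3)[OF m(1)]]
    by auto
  have "mor c N Z" using c Oo m by (simp add: mor_def)
  from comp_zero[OF this morD(1)[OF m(1)]] show ?thesis using c(2) by simp
qed

lemma dtri_comp_zero': "dtri C X Y Z f g h \<Longrightarrow> h \<bullet> g = zero_mor Y (sh C X)"
  using dtri_rotate dtri_comp_zero by blast

text \<open>The trivial triangle on \<open>W\<close> and the given triangle are both rotated once,
  so that TR3 completes \<open>a\<close> to a map \<open>c : W[1] \<rightarrow> X[1]\<close>.
  Fullness of the shift turns \<open>c\<close> into \<open>b\<close>, and faithfulness turns the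
  shifted equation into \<open>a = f \<bullet> b\<close>.\<close>

lemma dtri_exact_cov:
  assumes "dtri C X Y Z f g h" "mor a W Y" "g \<bullet> a = zero_mor W Z"
  obtains b where "mor b W X" "a = f \<bullet> b"
proof -
  note m = dtri_mor[OF assms(1)]
  have W: "W \<in> Obj C" using assms(2) morD by blast
  obtain N where N: "is_zero_obj C N" using zero_obj_exists by blast
  then have Oo: "N \<in> Obj C" by (simp add: is_zero_obj_def)
  have comm: "zero_mor N Z \<bullet> zero_mor W N = g \<bullet> a"
    using assms(3) comp_zero[OF mor_zero[OF Oo morD(2)[OF m(2)]] W] by simp
  from TR3[OF dtri_rotate[OF TR1_id[OF W N]] dtri_rotate[OF assms(1)] morD(3)[OF assms(2)]
      morD(3)[OF mor_zero[OF Oo morD(2)[OF m(2)]]] comm]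
  obtain c where c: "c \<in> arr C (sh C W) (sh C X)"
    "shm C a \<bullet> (\<ominus>\<^bsub>Hom C (sh C W) (sh C W)\<^esub> shm C (idm C W)) =
      (\<ominus>\<^bsub>Hom C (sh C X) (sh C Y)\<^esub> shm C f) \<bullet> c"
    by blast
  have cm: "mor c (sh C W) (sh C X)" using c W m sh_closed by (simp add: mor_def)
  obtain b where b: "mor b W X" "shm C b = c" using shm_surj[OF cm W morD(1)[OF m(1)]] by blast
  have ma: "mor (shm C a) (sh C W) (sh C Y)" "mor (shm C f) (sh C X) (sh C Y)"
    using mor_shm assms(2) m(1) by blast+
  \<comment> \<open>Each of the two rotations contributes one minus sign; the signs cancel.\<close>
  have "\<ominus>\<^bsub>Hom C (sh C W) (sh C Y)\<^esub> shm C a = \<ominus>\<^bsub>Hom C (sh C W) (sh C Y)\<^esub> (shm C f \<bullet> c)"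
    using c(2) comp_uminus[OF mor_id[OF sh_closed[OF W]] ma(1)] uminus_comp[OF cm ma(2)]
    by (simp add: shm_id W id_right_mor[OF ma(1)])
  then have "shm C a = shm C f \<bullet> c"
    by (rule uminus_mor_inj[OF _ ma(1) mor_comp[OF cm ma(2)]])
  also have "\<dots> = shm C (f \<bullet> b)" using shm_comp_mor[OF b(1) m(1)] b(2) by simp
  finally show thesis
    using that[OF b(1)] shm_inj[OF assms(2) mor_comp[OF b(1) m(1)]] by blast
qed

text \<open>TR3 maps the given triangle to
  \<open>N \<rightarrow> W \<rightarrow> W \<rightarrow> N[1]\<close> with \<open>N\<close> zero and
  the identity of \<open>W\<close> in the middle; the third component is the factorisation.\<close>

lemma dtri_exact_con:
  assumes "dtri C X Y Z f g h" "mor b Y W" "b \<bullet> f = zero_mor X W"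
  obtains c where "mor c Z W" "b = c \<bullet> g"
proof -
  note m = dtri_mor[OF assms(1)]
  have W: "W \<in> Obj C" using assms(2) morD by blast
  obtain N where N: "is_zero_obj C N" using zero_obj_exists by blast
  then have Oo: "N \<in> Obj C" by (simp add: is_zero_obj_def)
  \<comment> \<open>\<open>N[1]\<close> must be a zero object, because the triangle on
    \<open>N \<rightarrow> W \<rightarrow> W\<close> comes from the trivial triangle
    \<open>W \<rightarrow> W \<rightarrow> N[1]\<close> by reading TR2 backwards.\<close>
  have "idm C (sh C N) = zero_mor (sh C N) (sh C N)"
    using shm_id[OF Oo] shm_zero[OF Oo Oo] zero_obj_mor[OF N mor_id[OF Oo]] by simp
  then have shO: "is_zero_obj C (sh C N)"
    using is_zero_objI sh_closed[OF Oo] by blast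
  have "\<ominus>\<^bsub>Hom C (sh C N) (sh C W)\<^esub> shm C (zero_mor N W) = zero_mor (sh C N) (sh C W)"
    using zero_obj_mor[OF shO mor_uminus[OF mor_shm[OF mor_zero[OF Oo W]]]] by simp
  then have t: "dtri C N W W (zero_mor N W) (idm C W) (zero_mor W (sh C N))"
    using TR1_id[OF W shO]
      TR2[OF Oo W W morD(3)[OF mor_zero[OF Oo W]] id_closed[OF W] morD(3)[OF mor_zero[OF W sh_closed[OF Oo]]]]
    by simp
  have comm: "b \<bullet> f = zero_mor N W \<bullet> zero_mor X N"
    using assms(3) comp_zero[OF mor_zero[OF Oo W] morD(1)[OF m(1)]] by simp
  from TR3[OF assms(1) t morD(3)[OF mor_zero[OF morD(1)[OF m(1)] Oo]] morD(3)[OF assms(2)] comm]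
  obtain c where c: "c \<in> arr C Z W" "c \<bullet> g = idm C W \<bullet> b" by blast
  then show thesis
    using that[of c] id_left_mor[OF assms(2)] W m by (simp add: mor_def)
qed

section \<open>Retracts are direct summands, and \<open>T[1]\<close> is closed under
  retracts\<close>

text \<open>The complement of a split mono is its cone \<open>Z\<close>: the connecting map
  \<open>r\<close> is zero, so \<open>q : B \<rightarrow> Z\<close> has a section, and a corrected
  section completes \<open>i\<close> and \<open>p\<close> to a biproduct.\<close>

lemma retract_direct_summand:
  assumes i: "mor i A B" and p: "mor p B A" and pi: "p \<bullet> i = idm C A"
  shows "is_direct_summand C A B"
proof -
  note obj = morD(1)[OF i] morD(2)[OF i]
  obtain Z q r where t: "dtri C A B Z i q r"
    using TR1_cone[OF obj morD(3)[OF i]] by blast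
  note m = dtri_mor[OF t]
  have Z: "Z \<in> Obj C" using m morD by blast
  have qi: "q \<bullet> i = zero_mor A Z" using dtri_comp_zero[OF t] .
  have "(\<ominus>\<^bsub>Hom C (sh C A) (sh C B)\<^esub> shm C i) \<bullet> r = zero_mor Z (sh C B)"
    using dtri_comp_zero'[OF dtri_rotate[OF t]] .
  then have ir: "shm C i \<bullet> r = zero_mor Z (sh C B)"
    using uminus_comp[OF m(3) mor_shm[OF i]] uminus_mor_eq_zero[OF mor_comp[OF m(3) mor_shm[OF i]]] by simp
  \<comment> \<open>Two consecutive maps of the rotated triangle compose to zero, hence
    \<open>i[1] \<bullet> r = 0\<close>, and \<open>i[1]\<close> is split mono.\<close>
  have "r = shm C (p \<bullet> i) \<bullet> r"
    using pi shm_id obj id_left_mor[OF m(3)] by simp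
  also have "\<dots> = shm C p \<bullet> (shm C i \<bullet> r)"
    using shm_comp_mor[OF i p] assoc_mor[OF m(3) mor_shm[OF i] mor_shm[OF p]] by simp
  also have "\<dots> = zero_mor Z (sh C A)"
    using ir comp_zero[OF mor_shm[OF p] Z] by simp
  finally have "r \<bullet> idm C Z = zero_mor Z (sh C A)"
    using id_right_mor[OF m(3)] by simp
  then obtain j where j: "mor j Z B" "idm C Z = q \<bullet> j"
    using dtri_exact_cov[OF dtri_rotate[OF t] mor_id[OF Z]] by blast
  \<comment> \<open>Subtracting \<open>i \<bullet> p \<bullet> j\<close> makes the section
    orthogonal to \<open>p\<close>; since \<open>q \<bullet> i = 0\<close> it remains a section of
    \<open>q\<close>.\<close>
  define j' where "j' = minus_mor Z B j (i \<bullet> (p \<bullet> j))"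
  have pj: "mor (p \<bullet> j) Z A" "mor (i \<bullet> (p \<bullet> j)) Z B" using j i p mor_comp by blast+
  have j': "mor j' Z B" unfolding j'_def using j pj mor_minus by blast
  have pj': "p \<bullet> j' = zero_mor Z A"
    unfolding j'_def using comp_minus[OF j(1) pj(2) p] assoc_mor[OF pj(1) i p] pi
      id_left_mor[OF pj(1)] minus_mor_self[OF pj(1)] by simp
  have qj': "q \<bullet> j' = idm C Z"
    unfolding j'_def using comp_minus[OF j(1) pj(2) m(2)] assoc_mor[OF pj(1) i m(2)] qi
      zero_comp[OF pj(1) Z] minus_mor_zero[OF mor_comp[OF j(1) m(2)]] j(2) by simp
  have ip: "mor (i \<bullet> p) B B" and jq: "mor (j' \<bullet> q) B B"
    using i p j' m mor_comp by blast+
  have s: "mor (plus_mor B B (i \<bullet> p) (j' \<bullet> q)) B B" using mor_plus ip jq by blast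
  \<comment> \<open>\<open>D\<close> is the defect of the biproduct identity. As
    \<open>q \<bullet> D = 0\<close>, it factors through \<open>i\<close>; as
    \<open>p \<bullet> D = 0\<close>, the factor is zero.\<close>
  define D where "D = minus_mor B B (idm C B) (plus_mor B B (i \<bullet> p) (j' \<bullet> q))"
  have D: "mor D B B" unfolding D_def using mor_minus mor_id obj s by blast
  have qD: "q \<bullet> D = zero_mor B Z"
  proof -
    have "q \<bullet> (i \<bullet> p) = zero_mor B Z"
      using assoc_mor[OF p i m(2)] qi zero_comp[OF p Z] by simp
    moreover have "q \<bullet> (j' \<bullet> q) = q"
      using assoc_mor[OF m(2) j' m(2)] qj' id_left_mor[OF m(2)] by simp
    ultimately show ?thesis
      unfolding D_def using comp_minus[OF mor_id[OF obj(2)] s m(2)] comp_plus[OF ip jq m(2)]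
        id_right_mor[OF m(2)] plus_zero_mor(2)[OF m(2)] minus_mor_self[OF m(2)] by simp
  qed
  have pD: "p \<bullet> D = zero_mor B A"
  proof -
    have "p \<bullet> (i \<bullet> p) = p"
      using assoc_mor[OF p i p] pi id_left_mor[OF p] by simp
    moreover have "p \<bullet> (j' \<bullet> q) = zero_mor B A"
      using assoc_mor[OF m(2) j' p] pj' zero_comp[OF m(2) obj(1)] by simp
    ultimately show ?thesis
      unfolding D_def using comp_minus[OF mor_id[OF obj(2)] s p] comp_plus[OF ip jq p]
        id_right_mor[OF p] plus_zero_mor(1)[OF p] minus_mor_self[OF p] by simp
  qed
  obtain x where x: "mor x B A" "D = i \<bullet> x"
    using dtri_exact_cov[OF t D qD] by blast
  have "x = p \<bullet> D" using x assoc_mor[OF x(1) i p] pi id_left_mor[OF x(1)] by simp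
  then have "D = zero_mor B B" using x(2) pD comp_zero[OF i obj(2)] by simp
  then have "plus_mor B B (i \<bullet> p) (j' \<bullet> q) = idm C B"
    unfolding D_def using minus_mor_eq_zero[OF mor_id[OF obj(2)] s] by simp
  then have "is_direct_sum C [A, Z] B"
    using is_direct_sum_pairI[OF i p j' m(2) pi qj' pj' qi] by blast
  then show ?thesis unfolding is_direct_summand_def by blast
qed

text \<open>Write \<open>B\<close> as \<open>S[1]\<close> and, by essential surjectivity,
  \<open>A\<close> as \<open>Y[1]\<close> up to isomorphism. Full faithfulness of the shift makes
  \<open>Y\<close> a retract of \<open>S\<close>, hence a direct summand, and \<open>T\<close> is
  closed under these.\<close>

lemma shift_subcat_retract:
  assumes T: "closed_subcategory C T" and B: "B \<in> shift_subcat C T"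
    and i: "mor i A B" and p: "mor p B A" and pi: "p \<bullet> i = idm C A"
  shows "A \<in> shift_subcat C T"
proof -
  note obj = morD(1)[OF i] morD(2)[OF i]
  obtain S u where S: "S \<in> T" "is_iso C B (sh C S) u"
    using B unfolding shift_subcat_def isomorphic_def by blast
  have So: "S \<in> Obj C" using S(1) T unfolding closed_subcategory_def by blast
  obtain u' where u: "mor u B (sh C S)" "mor u' (sh C S) B" "u' \<bullet> u = idm C B"
    using is_isoE[OF S(2) obj(2) sh_closed[OF So]] by blast
  obtain Y v where Y: "Y \<in> Obj C" "is_iso C (sh C Y) A v"
    using sh_ess_surj[OF obj(1)] unfolding isomorphic_def by blast
  obtain v' where v: "mor v (sh C Y) A" "mor v' A (sh C Y)" "v' \<bullet> v = idm C (sh C Y)" "v \<bullet> v' = idm C A"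
    using is_isoE[OF Y(2) sh_closed[OF Y(1)] obj(1)] by blast
  have a: "mor (u \<bullet> (i \<bullet> v)) (sh C Y) (sh C S)" "mor (i \<bullet> v) (sh C Y) B"
    and b: "mor (v' \<bullet> (p \<bullet> u')) (sh C S) (sh C Y)" "mor (p \<bullet> u') (sh C S) A"
    using u v i p mor_comp by blast+
  obtain a' where a': "mor a' Y S" "shm C a' = u \<bullet> (i \<bullet> v)"
    using shm_surj[OF a(1) Y(1) So] by blast
  obtain b' where b': "mor b' S Y" "shm C b' = v' \<bullet> (p \<bullet> u')"
    using shm_surj[OF b(1) So Y(1)] by blast
  have "shm C (b' \<bullet> a') = (v' \<bullet> (p \<bullet> u')) \<bullet> (u \<bullet> (i \<bullet> v))"
    using shm_comp_mor[OF a'(1) b'(1)] a' b' by simp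
  also have "\<dots> = v' \<bullet> ((p \<bullet> u') \<bullet> (u \<bullet> (i \<bullet> v)))"
    using assoc_mor[OF a(1) b(2) v(2)] by simp
  also have "(p \<bullet> u') \<bullet> (u \<bullet> (i \<bullet> v)) = p \<bullet> (u' \<bullet> (u \<bullet> (i \<bullet> v)))"
    using assoc_mor[OF a(1) u(2) p] by simp
  also have "u' \<bullet> (u \<bullet> (i \<bullet> v)) = i \<bullet> v"
    using assoc_mor[OF a(2) u(1) u(2)] u(3) id_left_mor[OF a(2)] by simp
  also have "p \<bullet> (i \<bullet> v) = v"
    using assoc_mor[OF v(1) i p] pi id_left_mor[OF v(1)] by simp
  also have "v' \<bullet> v = shm C (idm C Y)" using v(3) shm_id[OF Y(1)] by simp
  finally have "b' \<bullet> a' = idm C Y"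
    using shm_inj[OF mor_comp[OF a'(1) b'(1)] mor_id[OF Y(1)]] by blast
  then have "is_direct_summand C Y S"
    using retract_direct_summand[OF a'(1) b'(1)] by blast
  then have "Y \<in> T" using T S(1) unfolding closed_subcategory_def by blast
  moreover have "isomorphic C A (sh C Y)"
    unfolding isomorphic_def using is_isoI[OF v(2,1,4,3)] by blast
  ultimately show ?thesis unfolding shift_subcat_def using obj(1) by blast
qed

end

section \<open>The radical\<close>

context linear_category
begin

text \<open>The Jacobson radical of the category in its quasi-regular form: \<open>1 - b a\<close>
  is left invertible for every \<open>b\<close>.\<close>

definition radical :: "'o \<Rightarrow> 'o \<Rightarrow> 'm set" where
  "radical Y B = {a. mor a Y B \<and>
     (\<forall>b. mor b B Y \<longrightarrow> (\<exists>v. mor v Y Y \<and> v \<bullet> minus_mor Y Y (idm C Y) (b \<bullet> a) = idm C Y))}"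

lemma radical_mor: "a \<in> radical Y B \<Longrightarrow> mor a Y B"
  by (simp add: radical_def)

lemma radicalI:
  assumes "mor a Y B"
    and "\<And>b. mor b B Y \<Longrightarrow> \<exists>v. mor v Y Y \<and> v \<bullet> minus_mor Y Y (idm C Y) (b \<bullet> a) = idm C Y"
  shows "a \<in> radical Y B"
  using assms by (simp add: radical_def)

lemma radicalE:
  assumes "a \<in> radical Y B" "mor b B Y"
  obtains v where "mor v Y Y" "v \<bullet> minus_mor Y Y (idm C Y) (b \<bullet> a) = idm C Y"
  using assms by (auto simp: radical_def)

lemma radical_zero:
  assumes "Y \<in> Obj C" "B \<in> Obj C"
  shows "zero_mor Y B \<in> radical Y B"
proof (rule radicalI[OF mor_zero[OF assms]])
  fix b assume "mor b B Y"
  then have "idm C Y \<bullet> minus_mor Y Y (idm C Y) (b \<bullet> zero_mor Y B) = idm C Y"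
    using comp_zero[OF _ assms(1)] minus_mor_zero[OF mor_id[OF assms(1)]]
      id_left_mor[OF mor_id[OF assms(1)]] by simp
  then show "\<exists>v. mor v Y Y \<and> v \<bullet> minus_mor Y Y (idm C Y) (b \<bullet> zero_mor Y B) = idm C Y"
    using mor_id[OF assms(1)] by blast
qed

text \<open>If \<open>v\<close> is a left inverse of \<open>u = 1 - b a\<close>, then
  \<open>v (1 - b (a + a')) = 1 - (v b) a'\<close>, which has a left inverse because
  \<open>a'\<close> is radical.\<close>

lemma radical_plus:
  assumes a: "a \<in> radical Y B" and a': "a' \<in> radical Y B"
  shows "plus_mor Y B a a' \<in> radical Y B"
proof -
  note m = radical_mor[OF a] radical_mor[OF a']
  have Y: "Y \<in> Obj C" using m morD by blast
  show ?thesis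
  proof (rule radicalI[OF mor_plus[OF m]])
    fix b assume b: "mor b B Y"
    define u where "u = minus_mor Y Y (idm C Y) (b \<bullet> a)"
    have ba: "mor (b \<bullet> a) Y Y" "mor (b \<bullet> a') Y Y" using b m mor_comp by blast+
    have u: "mor u Y Y" unfolding u_def using ba Y mor_id mor_minus by blast
    obtain v where v: "mor v Y Y" "v \<bullet> u = idm C Y"
      using radicalE[OF a b] unfolding u_def by blast
    have vb: "mor (v \<bullet> b) B Y" using v b mor_comp by blast
    obtain w where w: "mor w Y Y" "w \<bullet> minus_mor Y Y (idm C Y) ((v \<bullet> b) \<bullet> a') = idm C Y"
      using radicalE[OF a' vb] by blast
    have "minus_mor Y Y (idm C Y) (b \<bullet> plus_mor Y B a a') = minus_mor Y Y u (b \<bullet> a')"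
      unfolding u_def using minus_minus_mor[OF mor_id[OF Y] ba] comp_plus[OF m b] by simp
    moreover have "mor (minus_mor Y Y u (b \<bullet> a')) Y Y"
      using u ba mor_minus by blast
    moreover have "v \<bullet> minus_mor Y Y u (b \<bullet> a') = minus_mor Y Y (idm C Y) ((v \<bullet> b) \<bullet> a')"
      using comp_minus[OF u ba(2) v(1)] v(2) assoc_mor[OF m(2) b v(1)] by simp
    ultimately have "(w \<bullet> v) \<bullet> minus_mor Y Y (idm C Y) (b \<bullet> plus_mor Y B a a') = idm C Y"
      using assoc_mor[OF _ v(1) w(1)] w(2) by simp
    then show "\<exists>v. mor v Y Y \<and> v \<bullet> minus_mor Y Y (idm C Y) (b \<bullet> plus_mor Y B a a') = idm C Y"
      using mor_comp[OF v(1) w(1)] by blast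
  qed
qed

text \<open>With \<open>c = b a\<close>, a left inverse \<open>v\<close> of \<open>1 - p c\<close>
  yields the left inverse \<open>1 + c v p\<close> of \<open>1 - c p\<close>.\<close>

lemma radical_comp:
  assumes a: "a \<in> radical Y B" and p: "mor p W Y"
  shows "a \<bullet> p \<in> radical W B"
proof -
  note m = radical_mor[OF a]
  note obj = morD(1)[OF p] morD(2)[OF p]
  show ?thesis
  proof (rule radicalI[OF mor_comp[OF p m]])
    fix b assume b: "mor b B W"
    obtain v where v: "mor v Y Y" "v \<bullet> minus_mor Y Y (idm C Y) ((p \<bullet> b) \<bullet> a) = idm C Y"
      using radicalE[OF a mor_comp[OF b p]] by blast
    define c where "c = b \<bullet> a"
    have c: "mor c Y W" unfolding c_def using b m mor_comp by blast
    have pc: "mor (p \<bullet> c) Y Y" "(p \<bullet> b) \<bullet> a = p \<bullet> c"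
      unfolding c_def using b m p mor_comp assoc_mor by blast+
    define u where "u = minus_mor W W (idm C W) (c \<bullet> p)"
    have cp: "mor (c \<bullet> p) W W" using c p mor_comp by blast
    have u: "mor u W W" unfolding u_def using cp mor_id[OF obj(1)] mor_minus by blast
    have "p \<bullet> u = minus_mor Y Y (idm C Y) (p \<bullet> c) \<bullet> p"
      unfolding u_def using comp_minus[OF mor_id[OF obj(1)] cp p] minus_comp[OF p mor_id[OF obj(2)] pc(1)]
        id_right_mor[OF p] id_left_mor[OF p] assoc_mor[OF p c p] by simp
    then have "v \<bullet> (p \<bullet> u) = p"
      using assoc_mor[OF p mor_minus[OF mor_id[OF obj(2)] pc(1)] v(1)] v(2) pc(2) id_left_mor[OF p]
      by simp
    then have "(c \<bullet> (v \<bullet> p)) \<bullet> u = c \<bullet> p"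
      using assoc_mor[OF u mor_comp[OF p v(1)] c] assoc_mor[OF u p v(1)] by simp
    moreover have cvp: "mor (c \<bullet> (v \<bullet> p)) W W" using c v p mor_comp by blast
    ultimately have "plus_mor W W (idm C W) (c \<bullet> (v \<bullet> p)) \<bullet> u = idm C W"
      using plus_comp[OF u mor_id[OF obj(1)] cvp] id_left_mor[OF u]
        minus_plus_mor[OF mor_id[OF obj(1)] cp] unfolding u_def by simp
    moreover have "b \<bullet> (a \<bullet> p) = c \<bullet> p" unfolding c_def using assoc_mor[OF p m b] by simp
    ultimately show "\<exists>v. mor v W W \<and> v \<bullet> minus_mor W W (idm C W) (b \<bullet> (a \<bullet> p)) = idm C W"
      unfolding u_def using mor_plus[OF mor_id[OF obj(1)] cvp] by auto
  qed
qed

section \<open>Radical morphisms out of objects with local endomorphism ring and out of their direct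
  sums\<close>

text \<open>An ideal contains 0, but in the endomorphism ring of a zero object 0 is the identity and
  hence a unit, so the set of nonunits would be empty.\<close>

lemma local_not_zero_obj:
  assumes "local_ring (End_ring C Y)"
  shows "\<not> is_zero_obj C Y"
proof
  assume Y: "is_zero_obj C Y"
  then have Yo: "Y \<in> Obj C" by (simp add: is_zero_obj_def)
  have "arr C Y Y = {zero_mor Y Y}" using Y Yo unfolding is_zero_obj_def by blast
  moreover have "idm C Y = zero_mor Y Y"
    using zero_obj_mor[OF Y mor_id[OF Yo]] by simp
  moreover from this have "zero_mor Y Y \<bullet> zero_mor Y Y = idm C Y"
    using id_left_mor[OF mor_id[OF Yo]] by simp
  ultimately have "carrier (End_ring C Y) - Units (End_ring C Y) = {}"
    by (auto simp: End_ring_def Units_def)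
  moreover have "ideal (carrier (End_ring C Y) - Units (End_ring C Y)) (End_ring C Y)"
    using assms by (simp add: local_ring_def)
  then have "\<zero>\<^bsub>End_ring C Y\<^esub> \<in> carrier (End_ring C Y) - Units (End_ring C Y)"
    by (rule additive_subgroup.zero_closed[OF ideal.axioms(1)])
  ultimately show False by blast
qed

text \<open>A unit \<open>b a\<close> would give \<open>a\<close> a left inverse, so
  \<open>b a\<close> is a nonunit. Nonunits are closed under addition and
  \<open>(1 - b a) + b a = 1\<close>, so \<open>1 - b a\<close> is a unit.\<close>

lemma radical_local:
  assumes loc: "local_ring (End_ring C Y)" and a: "mor a Y B"
    and no: "\<And>b. mor b B Y \<Longrightarrow> b \<bullet> a \<noteq> idm C Y"
  shows "a \<in> radical Y B"
proof (rule radicalI[OF a])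
  fix b assume b: "mor b B Y"
  let ?R = "End_ring C Y"
  define u where "u = minus_mor Y Y (idm C Y) (b \<bullet> a)"
  have Y: "Y \<in> Obj C" using a morD by blast
  have ba: "mor (b \<bullet> a) Y Y" using a b mor_comp by blast
  have u: "mor u Y Y" unfolding u_def using ba Y mor_id mor_minus by blast
  have id_unit: "idm C Y \<in> Units ?R"
    unfolding Units_def End_ring_def using id_closed[OF Y] id_left[OF Y Y id_closed[OF Y]] by auto
  have I: "ideal (carrier ?R - Units ?R) ?R" using loc by (simp add: local_ring_def)
  have "b \<bullet> a \<notin> Units ?R"
  proof
    assume "b \<bullet> a \<in> Units ?R"
    then obtain w where w: "mor w Y Y" "w \<bullet> (b \<bullet> a) = idm C Y"
      unfolding Units_def End_ring_def mor_def using Y by auto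
    then show False
      using no[OF mor_comp[OF b w(1)]] assoc_mor[OF a b w(1)] by simp
  qed
  then have "b \<bullet> a \<in> carrier ?R - Units ?R"
    using ba by (simp add: End_ring_def mor_def)
  moreover have "u \<oplus>\<^bsub>?R\<^esub> (b \<bullet> a) = idm C Y"
    unfolding u_def using minus_plus_mor[OF mor_id[OF Y] ba] by (simp add: End_ring_def)
  ultimately have "u \<notin> carrier ?R - Units ?R"
    using additive_subgroup.a_closed[OF ideal.axioms(1)[OF I], of u "b \<bullet> a"] id_unit by auto
  then have "u \<in> Units ?R" using u by (simp add: End_ring_def mor_def)
  then show "\<exists>v. mor v Y Y \<and> v \<bullet> minus_mor Y Y (idm C Y) (b \<bullet> a) = idm C Y"
    unfolding u_def[symmetric] Units_def End_ring_def mor_def using Y by auto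
qed

text \<open>The well-typedness of the sum is carried through the induction because distributing
  \<open>h\<close> over the next summand requires it.\<close>

lemma comp_finsum_radical:
  assumes h: "mor h X B" and "finite I"
    and F: "\<And>i. i \<in> I \<Longrightarrow> mor (F i) X X \<and> h \<bullet> F i \<in> radical X B"
  shows "mor (\<Oplus>\<^bsub>Hom C X X\<^esub> i \<in> I. F i) X X \<and> h \<bullet> (\<Oplus>\<^bsub>Hom C X X\<^esub> i \<in> I. F i) \<in> radical X B"
  using assms(2) F
proof (induction I)
  case empty
  note obj = morD(1)[OF h] morD(2)[OF h]
  interpret abelian_group "Hom C X X" using obj abelian_group_Hom by blast
  show ?case using comp_zero[OF h obj(1)] radical_zero[OF obj] mor_zero[OF obj(1) obj(1)] by simp
next
  case (insert i I)
  interpret abelian_group "Hom C X X" using h morD abelian_group_Hom by blast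
  have "(\<Oplus>\<^bsub>Hom C X X\<^esub> i \<in> insert i I. F i) = plus_mor X X (F i) (\<Oplus>\<^bsub>Hom C X X\<^esub> i \<in> I. F i)"
    using insert.hyps insert.prems by (intro finsum_insert) (auto simp: mor_def)
  moreover have Fi: "mor (F i) X X" "h \<bullet> F i \<in> radical X B" using insert.prems by auto
  moreover have S: "mor (\<Oplus>\<^bsub>Hom C X X\<^esub> i \<in> I. F i) X X" "h \<bullet> (\<Oplus>\<^bsub>Hom C X X\<^esub> i \<in> I. F i) \<in> radical X B"
    using insert.IH insert.prems by auto
  ultimately show ?case
    using comp_plus[OF Fi(1) S(1) h] radical_plus[OF Fi(2) S(2)] mor_plus[OF Fi(1) S(1)] by simp
qed

text \<open>Expand \<open>h\<close> as the sum of
  \<open>(h \<bullet> \<iota> n) \<bullet> \<pi> n\<close>; each term is radical by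
  \<open>radical_comp\<close>. The hypothesis ranges over all split monos from the summands because
  the injections are hidden under the existential quantifier of
  \<open>is_direct_sum\<close>.\<close>

lemma radical_direct_sum:
  assumes "is_direct_sum C Xs X" "mor h X B"
    and "\<And>Y i. Y \<in> set Xs \<Longrightarrow> mor i Y X \<Longrightarrow> (\<exists>p. mor p X Y \<and> p \<bullet> i = idm C Y) \<Longrightarrow> h \<bullet> i \<in> radical Y B"
  shows "h \<in> radical X B"
proof -
  obtain \<iota> \<pi> where sub: "set Xs \<subseteq> Obj C" and X: "X \<in> Obj C"
    and io: "\<forall>i < length Xs. \<iota> i \<in> arr C (Xs ! i) X \<and> \<pi> i \<in> arr C X (Xs ! i)"
    and orth: "\<forall>i < length Xs. \<forall>j < length Xs.
           \<pi> i \<bullet> \<iota> j = (if i = j then idm C (Xs ! i) else zero_mor (Xs ! j) (Xs ! i))"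
    and id: "(\<Oplus>\<^bsub>Hom C X X\<^esub> i \<in> {..<length Xs}. \<iota> i \<bullet> \<pi> i) = idm C X"
    using assms(1) unfolding is_direct_sum_def by blast
  have "mor (\<iota> n \<bullet> \<pi> n) X X \<and> h \<bullet> (\<iota> n \<bullet> \<pi> n) \<in> radical X B" if n: "n \<in> {..<length Xs}" for n
  proof -
    have n': "n < length Xs" using n by simp
    have m: "mor (\<iota> n) (Xs ! n) X" "mor (\<pi> n) X (Xs ! n)"
      using n' io X nth_mem[OF n'] sub by (auto simp: mor_def)
    have "\<pi> n \<bullet> \<iota> n = idm C (Xs ! n)" using orth n' by simp
    then have "h \<bullet> \<iota> n \<in> radical (Xs ! n) B"
      using assms(3)[OF nth_mem[OF n'] m(1)] m(2) by blast
    then have "(h \<bullet> \<iota> n) \<bullet> \<pi> n \<in> radical X B" using radical_comp m(2) by blast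
    then show ?thesis using assoc_mor[OF m(2,1) assms(2)] mor_comp[OF m(2,1)] by simp
  qed
  from comp_finsum_radical[OF assms(2) finite_lessThan this, of "length Xs" "\<lambda>n. n"]
  have "h \<bullet> idm C X \<in> radical X B" using id by simp
  then show ?thesis using id_right_mor[OF assms(2)] by simp
qed

text \<open>The map \<open>t = s h s\<close> is fixed by \<open>s h\<close>, hence killed by
  \<open>1 - s h\<close>. The latter is left invertible, so \<open>t = 0\<close>, and
  \<open>h t\<close> is the idempotent itself.\<close>

lemma idempotent_through_radical:
  assumes h: "h \<in> radical X B" and s: "mor s B X" and idem: "(h \<bullet> s) \<bullet> (h \<bullet> s) = h \<bullet> s"
  shows "h \<bullet> s = zero_mor B B"
proof -
  note hm = radical_mor[OF h]
  note obj = morD(1)[OF hm] morD(2)[OF hm]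
  have e: "mor (h \<bullet> s) B B" "mor (s \<bullet> h) X X" using hm s mor_comp by blast+
  define u where "u = minus_mor X X (idm C X) (s \<bullet> h)"
  have u: "mor u X X" unfolding u_def using e(2) mor_id[OF obj(1)] mor_minus by blast
  obtain v where v: "mor v X X" "v \<bullet> u = idm C X"
    using radicalE[OF h s] unfolding u_def by blast
  define t where "t = s \<bullet> (h \<bullet> s)"
  have t: "mor t B X" unfolding t_def using s e mor_comp by blast
  have "(s \<bullet> h) \<bullet> t = t"
    unfolding t_def using assoc_mor[OF mor_comp[OF e(1) s] hm s] assoc_mor[OF e(1) s hm] idem by simp
  then have "u \<bullet> t = zero_mor B X"
    unfolding u_def using minus_comp[OF t mor_id[OF obj(1)] e(2)] id_left_mor[OF t] minus_mor_self[OF t]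
    by simp
  then have "t = zero_mor B X"
    using assoc_mor[OF t u v(1)] v(2) id_left_mor[OF t] comp_zero[OF v(1) obj(2)] by simp
  then have "h \<bullet> t = zero_mor B B" using comp_zero[OF hm obj(2)] by simp
  moreover have "h \<bullet> t = h \<bullet> s" unfolding t_def using assoc_mor[OF e(1) s hm] idem by simp
  ultimately show ?thesis by simp
qed

end

context triangulated_category
begin

text \<open>On a Krull-Schmidt summand \<open>Y\<close> of \<open>X\<close>, a left inverse of
  \<open>h \<bullet> i\<close> would make \<open>Y\<close> a retract of \<open>B\<close>, hence an
  object of \<open>T[1]\<close>. By hypothesis \<open>Y\<close> would then be zero, which a local
  endomorphism ring excludes.\<close>

lemma radical_into_shift_subcat:
  assumes KS: "krull_schmidt C" and T: "closed_subcategory C T"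
    and no: "\<And>Y. is_direct_summand C Y X \<Longrightarrow> Y \<in> shift_subcat C T \<Longrightarrow> is_zero_obj C Y"
    and B: "B \<in> shift_subcat C T" and h: "mor h X B"
  shows "h \<in> radical X B"
proof -
  obtain Xs where Xs: "is_direct_sum C Xs X" "\<forall>Y \<in> set Xs. local_ring (End_ring C Y)"
    using KS morD(1)[OF h] unfolding krull_schmidt_def by blast
  show ?thesis
  proof (rule radical_direct_sum[OF Xs(1) h])
    fix Y i assume Y: "Y \<in> set Xs" and i: "mor i Y X" and "\<exists>p. mor p X Y \<and> p \<bullet> i = idm C Y"
    then have "is_direct_summand C Y X" using retract_direct_summand by blast
    moreover have loc: "local_ring (End_ring C Y)" using Xs(2) Y by blast
    ultimately have "Y \<notin> shift_subcat C T" using no local_not_zero_obj by blast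
    then show "h \<bullet> i \<in> radical Y B"
      using radical_local[OF loc mor_comp[OF i h]] shift_subcat_retract[OF T B mor_comp[OF i h]]
      by blast
  qed
qed

section \<open>The triangle \<open>T1 \<rightarrow> T0 \<rightarrow> X\<close>, and the ideal
  expressed through its first morphism\<close>

text \<open>Membership in \<open>star\<close> gives
  \<open>T0 \<rightarrow> X \<rightarrow> Y \<rightarrow> T0[1]\<close> with \<open>Y\<close>
  isomorphic to some \<open>T1[1]\<close>. Replacing \<open>Y\<close> by \<open>T1[1]\<close> and
  rotating backwards produces the presentation of \<open>X\<close>.\<close>

lemma star_triangle:
  assumes T: "closed_subcategory C T" and X: "X \<in> star C T (shift_subcat C T)"
  obtains T1 T0 f g h where "T1 \<in> T" "T0 \<in> T" "dtri C T1 T0 X f g h"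
proof -
  have sub: "T \<subseteq> Obj C" using T by (simp add: closed_subcategory_def)
  obtain T0 Y g q r where T0: "T0 \<in> T" and Y: "Y \<in> shift_subcat C T" and t: "dtri C T0 X Y g q r"
    using X unfolding star_def by blast
  note m = dtri_mor[OF t]
  obtain T1 c where T1: "T1 \<in> T" and c: "is_iso C Y (sh C T1) c"
    using Y unfolding shift_subcat_def isomorphic_def by blast
  have obj: "T0 \<in> Obj C" "T1 \<in> Obj C" "X \<in> Obj C" "Y \<in> Obj C" "sh C T1 \<in> Obj C" "sh C T0 \<in> Obj C"
    using T0 T1 sub m sh_closed by (auto simp: mor_def)
  obtain c' where c': "mor c Y (sh C T1)" "mor c' (sh C T1) Y" "c' \<bullet> c = idm C Y"
    using is_isoE[OF c obj(4,5)] by blast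
  define h where "h = c \<bullet> q"
  define w where "w = r \<bullet> c'"
  have h: "mor h X (sh C T1)" and w: "mor w (sh C T1) (sh C T0)"
    unfolding h_def w_def using m c' mor_comp by blast+
  have wc: "w \<bullet> c = r"
    unfolding w_def using assoc_mor[OF c'(1,2) m(3)] c'(3) id_right_mor[OF m(3)] by simp
  have "dtri C T0 X (sh C T1) g h w"
  proof (rule TR1_iso[OF t obj(1,3,5) morD(3)[OF m(1)] morD(3)[OF h] morD(3)[OF w]
        is_iso_id[OF obj(1)] is_iso_id[OF obj(3)] c])
    show "idm C X \<bullet> g = g \<bullet> idm C T0" using id_left_mor[OF m(1)] id_right_mor[OF m(1)] by simp
    show "c \<bullet> q = h \<bullet> idm C X" using id_right_mor[OF h] by (simp add: h_def)
    show "shm C (idm C T0) \<bullet> r = w \<bullet> c"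
      using shm_id[OF obj(1)] id_left_mor[OF m(3)] wc by simp
  qed
  \<comment> \<open>Reading TR2 backwards requires the third map \<open>w\<close> to be
    \<open>-f[1]\<close>; fullness of the shift provides such an \<open>f\<close>.\<close>
  moreover obtain f where f: "mor f T1 T0" "shm C f = \<ominus>\<^bsub>Hom C (sh C T1) (sh C T0)\<^esub> w"
    using shm_surj[OF mor_uminus[OF w] obj(2,1)] by blast
  ultimately have "dtri C T1 T0 X f g h"
    using TR2[OF obj(2,1,3) morD(3)[OF f(1)] morD(3)[OF m(1)] morD(3)[OF h]] uminus_uminus_mor[OF w]
    by simp
  then show thesis using that T1 T0 by blast
qed

text \<open>Rigidity is stated for literal shifts \<open>U[1]\<close>; this carries it to all
  objects isomorphic to one.\<close>

lemma rigid_shift_subcat: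
  assumes T: "closed_subcategory C T" "rigid C T" and S: "S \<in> T" "B \<in> shift_subcat C T" and a: "mor a S B"
  shows "a = zero_mor S B"
proof -
  obtain U c where U: "U \<in> T" and c: "is_iso C B (sh C U) c"
    using S(2) unfolding shift_subcat_def isomorphic_def by blast
  have obj: "B \<in> Obj C" "sh C U \<in> Obj C" "S \<in> Obj C"
    using U T(1) a sh_closed morD unfolding closed_subcategory_def by blast+
  obtain c' where c': "mor c B (sh C U)" "mor c' (sh C U) B" "c' \<bullet> c = idm C B"
    using is_isoE[OF c obj(1,2)] by blast
  have "c \<bullet> a = zero_mor S (sh C U)"
    using T(2) S(1) U mor_comp[OF a c'(1)] unfolding rigid_def mor_def by blast
  then show ?thesis
    using assoc_mor[OF a c'(1,2)] c'(3) id_left_mor[OF a] comp_zero[OF c'(2) obj(3)] by simp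
qed

lemma sh_in_shift_subcat:
  assumes "closed_subcategory C T" "S \<in> T"
  shows "sh C S \<in> shift_subcat C T"
proof -
  have "sh C S \<in> Obj C" using assms sh_closed unfolding closed_subcategory_def by blast
  then show ?thesis
    using assms is_iso_id unfolding shift_subcat_def isomorphic_def by blast
qed

text \<open>This is exactness at \<open>T1[1]\<close> of the twice rotated triangle
  \<open>X \<rightarrow> T1[1] \<rightarrow> T0[1]\<close>, tested on \<open>S[1]\<close>. It
  identifies the kernel of \<open>f \<bullet> -\<close> with the shifted morphisms that factor
  through \<open>h\<close>.\<close>

lemma dtri_connecting_comp_zero:
  assumes t: "dtri C T1 T0 X f g h" and x: "mor x S T1"
  shows "f \<bullet> x = zero_mor S T0 \<longleftrightarrow> (\<exists>s. mor s (sh C S) X \<and> shm C x = h \<bullet> s)"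
proof -
  note m = dtri_mor[OF t]
  note t' = dtri_rotate[OF t]
  note fx = mor_comp[OF x m(1)]
  note mf = mor_shm[OF m(1)] and mx = mor_shm[OF x]
  have S: "S \<in> Obj C" and T0: "T0 \<in> Obj C" using x m morD by blast+
  \<comment> \<open>Neither the rotation sign nor the faithful shift affects whether the composite
    vanishes.\<close>
  have iff: "(\<ominus>\<^bsub>Hom C (sh C T1) (sh C T0)\<^esub> shm C f) \<bullet> shm C x = zero_mor (sh C S) (sh C T0) \<longleftrightarrow>
      f \<bullet> x = zero_mor S T0"
    using uminus_comp[OF mx mf] uminus_mor_eq_zero[OF mor_comp[OF mx mf]]
      shm_comp_mor[OF x m(1)] shm_eq_zero[OF fx] shm_zero[OF S T0] by auto
  show ?thesis
  proof
    assume "f \<bullet> x = zero_mor S T0"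
    then show "\<exists>s. mor s (sh C S) X \<and> shm C x = h \<bullet> s"
      using dtri_exact_cov[OF dtri_rotate[OF t'] mx] iff by blast
  next
    assume "\<exists>s. mor s (sh C S) X \<and> shm C x = h \<bullet> s"
    then obtain s where s: "mor s (sh C S) X" "shm C x = h \<bullet> s" by blast
    have "(\<ominus>\<^bsub>Hom C (sh C T1) (sh C T0)\<^esub> shm C f) \<bullet> shm C x =
        ((\<ominus>\<^bsub>Hom C (sh C T1) (sh C T0)\<^esub> shm C f) \<bullet> h) \<bullet> s"
      using assoc_mor[OF s(1) m(3) mor_uminus[OF mf]] s(2) by simp
    also have "\<dots> = zero_mor (sh C S) (sh C T0)"
      using dtri_comp_zero'[OF t'] zero_comp[OF s(1) sh_closed[OF T0]] by simp
    finally show "f \<bullet> x = zero_mor S T0" using iff by blast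
  qed
qed

text \<open>The right-hand side says that \<open>\<H> f\<close> is mono. Composites
  \<open>S[1] \<rightarrow> X \<rightarrow> T1[1]\<close> ending in \<open>h\<close> are exactly the
  shifted elements of its kernel, and rigidity makes every morphism from \<open>X\<close> to
  \<open>T[1]\<close> factor through \<open>h\<close>, so these composites decide the whole
  ideal.\<close>

lemma factor_ideal_zero_iff:
  assumes T: "closed_subcategory C T" "rigid C T" and T01: "T1 \<in> T" "T0 \<in> T"
    and t: "dtri C T1 T0 X f g h"
  shows "factor_ideal_zero C X (shift_subcat C T) \<longleftrightarrow>
    (\<forall>S \<in> T. \<forall>x. mor x S T1 \<and> f \<bullet> x = zero_mor S T0 \<longrightarrow> x = zero_mor S T1)"
proof
  note m = dtri_mor[OF t]
  assume fi: "factor_ideal_zero C X (shift_subcat C T)"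
  show "\<forall>S \<in> T. \<forall>x. mor x S T1 \<and> f \<bullet> x = zero_mor S T0 \<longrightarrow> x = zero_mor S T1"
  proof (intro ballI allI impI)
    fix S x assume S: "S \<in> T" and x: "mor x S T1 \<and> f \<bullet> x = zero_mor S T0"
    then obtain s where s: "mor s (sh C S) X" "shm C x = h \<bullet> s"
      using dtri_connecting_comp_zero[OF t] by blast
    have "shm C x \<in> factor_ideal C X (sh C S) (sh C T1)"
      unfolding factor_ideal_def using s m(3) mor_shm[of x S T1] x unfolding mor_def by blast
    then have "shm C x = zero_mor (sh C S) (sh C T1)"
      using fi sh_in_shift_subcat[OF T(1)] S T01(1) unfolding factor_ideal_zero_def by blast
    then show "x = zero_mor S T1" using shm_eq_zero x by blast
  qed
next
  note m = dtri_mor[OF t]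
  assume mono: "\<forall>S \<in> T. \<forall>x. mor x S T1 \<and> f \<bullet> x = zero_mor S T0 \<longrightarrow> x = zero_mor S T1"
  have "b \<bullet> a = zero_mor A B"
    if A: "A \<in> shift_subcat C T" and B: "B \<in> shift_subcat C T" and a: "mor a A X" and b: "mor b X B" for A B a b
  proof -
    obtain S c where S: "S \<in> T" and c: "is_iso C A (sh C S) c"
      using A unfolding shift_subcat_def isomorphic_def by blast
    have obj: "A \<in> Obj C" "sh C S \<in> Obj C" "S \<in> Obj C" "T1 \<in> Obj C" "B \<in> Obj C"
      using S T01 T(1) a b sh_closed morD unfolding closed_subcategory_def by blast+
    obtain c' where c': "mor c A (sh C S)" "mor c' (sh C S) A" "c' \<bullet> c = idm C A"
      using is_isoE[OF c obj(1,2)] by blast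
    have ac: "mor (a \<bullet> c') (sh C S) X" using c' a mor_comp by blast
    \<comment> \<open>This composite goes from \<open>T0\<close> to an object of
      \<open>T[1]\<close>, so rigidity kills it and \<open>b\<close> descends along
      \<open>h\<close>.\<close>
    have "b \<bullet> g = zero_mor T0 B"
      using rigid_shift_subcat[OF T T01(2) B mor_comp[OF m(2) b]] .
    then obtain b' where b': "mor b' (sh C T1) B" "b = b' \<bullet> h"
      using dtri_exact_con[OF dtri_rotate[OF t] b] by blast
    obtain x where x: "mor x S T1" "shm C x = h \<bullet> (a \<bullet> c')"
      using shm_surj[OF mor_comp[OF ac m(3)] obj(3,4)] by blast
    then have "x = zero_mor S T1"
      using mono S dtri_connecting_comp_zero[OF t x(1)] ac by blast
    then have "h \<bullet> (a \<bullet> c') = zero_mor (sh C S) (sh C T1)"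
      using x(2) shm_zero[OF obj(3,4)] by simp
    then have "b \<bullet> (a \<bullet> c') = zero_mor (sh C S) B"
      using b' assoc_mor[OF ac m(3) b'(1)] comp_zero[OF b'(1) obj(2)] by simp
    then have "(b \<bullet> a) \<bullet> c' = zero_mor (sh C S) B"
      using assoc_mor[OF c'(2) a b] by simp
    then show ?thesis
      using assoc_mor[OF c'(1,2) mor_comp[OF a b]] c'(3) id_right_mor[OF mor_comp[OF a b]]
        zero_comp[OF c'(1) obj(5)] by simp
  qed
  note prod = this
  show "factor_ideal_zero C X (shift_subcat C T)"
    unfolding factor_ideal_zero_def
  proof (intro ballI equalityI subsetI)
    fix A B u assume A: "A \<in> shift_subcat C T" and B: "B \<in> shift_subcat C T"
    have obj: "A \<in> Obj C" "B \<in> Obj C" "X \<in> Obj C"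
      using A B m morD by (auto simp: shift_subcat_def)
    show "u \<in> {zero_mor A B}" if "u \<in> factor_ideal C X A B"
      using prod[OF A B] that obj by (auto simp: factor_ideal_def mor_def)
    \<comment> \<open>Vanishing of the ideal is an equality with the zero singleton, so zero itself
      must be exhibited as a composite through \<open>X\<close>.\<close>
    show "u \<in> factor_ideal C X A B" if "u \<in> {zero_mor A B}"
    proof -
      have "u = zero_mor X B \<bullet> zero_mor A X"
        using that zero_comp[OF mor_zero[OF obj(1,3)] obj(2)] by simp
      then show ?thesis
        using that mor_zero[OF obj(1,3)] mor_zero[OF obj(3,2)] mor_zero[OF obj(1,2)]
        unfolding factor_ideal_def by (auto simp: mor_def intro!: bexI)
    qed
  qed
qed

end

section \<open>Projective resolutions of representable functors\<close>

context linear_category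
begin

lemma Hfun_simps:
  "carrier (fobj (Hfun C X) S) = arr C S X"
  "x \<otimes>\<^bsub>fobj (Hfun C X) S\<^esub> y = plus_mor S X x y"
  "\<one>\<^bsub>fobj (Hfun C X) S\<^esub> = zero_mor S X"
  "fmap (Hfun C X) f x = x \<bullet> f"
  by (simp_all add: Hfun_def)

lemma comm_group_Hfun:
  assumes "S \<in> Obj C" "X \<in> Obj C"
  shows "comm_group (fobj (Hfun C X) S)"
proof -
  interpret abelian_group "Hom C S X" using assms abelian_group_Hom by blast
  show ?thesis
    by (rule comm_groupI) (auto simp: Hfun_simps a_ac intro: l_neg)
qed

lemma additive_Hfun:
  assumes "T \<subseteq> Obj C" "X \<in> Obj C"
  shows "additive_cfunctor C T (Hfun C X)"
  unfolding additive_cfunctor_def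
proof (intro conjI ballI)
  fix S assume "S \<in> T" then have S: "S \<in> Obj C" using assms by blast
  show "comm_group (fobj (Hfun C X) S)" using comm_group_Hfun S assms by blast
  show "fmap (Hfun C X) (idm C S) x = x" if "x \<in> carrier (fobj (Hfun C X) S)" for x
    using that id_right[OF S assms(2)] by (simp add: Hfun_simps)
  fix S' assume "S' \<in> T" then have S': "S' \<in> Obj C" using assms by blast
  fix f assume f: "f \<in> arr C S S'"
  show "fmap (Hfun C X) f \<in> hom (fobj (Hfun C X) S') (fobj (Hfun C X) S)"
    by (rule homI) (use comp_closed[OF S S' assms(2) f] comp_add_left[OF S S' assms(2) f]
      in \<open>simp_all add: Hfun_simps\<close>)
  show "fmap (Hfun C X) (f \<oplus>\<^bsub>Hom C S S'\<^esub> g) x =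
      fmap (Hfun C X) f x \<otimes>\<^bsub>fobj (Hfun C X) S\<^esub> fmap (Hfun C X) g x"
    if "g \<in> arr C S S'" "x \<in> carrier (fobj (Hfun C X) S')" for g x
    using that comp_add_right[OF S S' assms(2) f] by (simp add: Hfun_simps)
  fix S'' assume "S'' \<in> T" then have S'': "S'' \<in> Obj C" using assms by blast
  show "fmap (Hfun C X) (g \<bullet> f) x = fmap (Hfun C X) f (fmap (Hfun C X) g x)"
    if "g \<in> arr C S' S''" "x \<in> carrier (fobj (Hfun C X) S'')" for g x
    using that comp_assoc[OF S S' S'' assms(2) f] by (simp add: Hfun_simps)
qed

lemma nat_trans_Hfun:
  assumes T: "T \<subseteq> Obj C" and f: "mor f X Y"
  shows "nat_trans C T (Hfun C X) (Hfun C Y) (\<lambda>S x. f \<bullet> x)"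
  unfolding nat_trans_def
proof (intro conjI ballI)
  note XY = morD[OF f]
  fix S assume "S \<in> T" then have S: "S \<in> Obj C" using T by blast
  show "(\<lambda>x. f \<bullet> x) \<in> hom (fobj (Hfun C X) S) (fobj (Hfun C Y) S)"
    by (rule homI) (use comp_closed[OF S XY(1,2) _ XY(3)] comp_add_right[OF S XY(1,2) _ _ XY(3)]
      in \<open>simp_all add: Hfun_simps\<close>)
  fix S' g x assume "S' \<in> T" and g: "g \<in> arr C S S'" and x: "x \<in> carrier (fobj (Hfun C X) S')"
  then have S': "S' \<in> Obj C" using T by blast
  show "f \<bullet> fmap (Hfun C X) g x = fmap (Hfun C Y) g (f \<bullet> x)"
    using comp_assoc[OF S S' XY(1,2) g _ XY(3)] x by (simp add: Hfun_simps)
qed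

lemma exact_Hfun:
  assumes T: "T \<subseteq> Obj C" and f: "mor f W X" and g: "mor g X Y"
    and gf: "g \<bullet> f = zero_mor W Y"
    and ex: "\<And>S a. S \<in> T \<Longrightarrow> mor a S X \<Longrightarrow> g \<bullet> a = zero_mor S Y \<Longrightarrow> \<exists>b. mor b S W \<and> a = f \<bullet> b"
  shows "exact_at T (Hfun C W) (Hfun C X) (Hfun C Y) (\<lambda>S x. f \<bullet> x) (\<lambda>S x. g \<bullet> x)"
  unfolding exact_at_def
proof (intro ballI equalityI subsetI)
  fix S a assume S: "S \<in> T"
  then have So: "S \<in> Obj C" using T by blast
  show "a \<in> kernel (fobj (Hfun C X) S) (fobj (Hfun C Y) S) (\<lambda>x. g \<bullet> x)"
    if im: "a \<in> (\<lambda>x. f \<bullet> x) ` carrier (fobj (Hfun C W) S)"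
  proof -
    obtain x where "x \<in> arr C S W" and a: "a = f \<bullet> x" using im unfolding Hfun_simps by blast
    then have x: "mor x S W" using morI[OF So morD(1)[OF f]] by blast
    then have "g \<bullet> a = zero_mor S Y"
      using a assoc_mor[OF x f g] gf zero_comp[OF x morD(2)[OF g]] by simp
    then show ?thesis
      using a mor_comp[OF x f] by (simp add: kernel_def Hfun_simps mor_def)
  qed
  show "a \<in> (\<lambda>x. f \<bullet> x) ` carrier (fobj (Hfun C W) S)"
    if "a \<in> kernel (fobj (Hfun C X) S) (fobj (Hfun C Y) S) (\<lambda>x. g \<bullet> x)"
  proof -
    have "mor a S X" "g \<bullet> a = zero_mor S Y"
      using that So g by (auto simp: kernel_def Hfun_simps mor_def)
    then show ?thesis using ex[OF S] by (auto simp: Hfun_simps mor_def)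
  qed
qed

lemma Hfun_mod_cat:
  assumes T: "T \<subseteq> Obj C" and X: "X \<in> T"
  shows "Hfun C X \<in> mod_cat C T"
proof -
  have Xo: "X \<in> Obj C" using assms by blast
  \<comment> \<open>The presentation uses \<open>X\<close> twice, with the zero map followed by the
    identity.\<close>
  have "exact_at T (Hfun C X) (Hfun C X) (Hfun C X) (\<lambda>S x. zero_mor X X \<bullet> x) (\<lambda>S x. idm C X \<bullet> x)"
  proof (rule exact_Hfun[OF T mor_zero[OF Xo Xo] mor_id[OF Xo]])
    show "idm C X \<bullet> zero_mor X X = zero_mor X X" using comp_zero[OF mor_id[OF Xo] Xo] .
    fix S a assume "mor a S X" "idm C X \<bullet> a = zero_mor S X"
    then show "\<exists>b. mor b S X \<and> a = zero_mor X X \<bullet> b"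
      using id_left_mor zero_comp Xo by auto
  qed
  moreover have "epi T (Hfun C X) (Hfun C X) (\<lambda>S x. idm C X \<bullet> x)"
    unfolding epi_def using id_left[OF _ Xo] T by (force simp: Hfun_simps)
  ultimately have "finitely_presented C T (Hfun C X)"
    unfolding finitely_presented_def
    using X nat_trans_Hfun[OF T mor_zero[OF Xo Xo]] nat_trans_Hfun[OF T mor_id[OF Xo]] by blast
  then show ?thesis using additive_Hfun[OF T Xo] by (simp add: mod_cat_def)
qed

section \<open>The Yoneda lemma and lifting from projective functors\<close>

text \<open>One half of Yoneda: an element of \<open>F\<close> at \<open>X\<close> induces a
  transformation from the representable functor. The other half,
  \<open>nat_trans_Hfun_apply\<close>, recovers a transformation from its value at the
  identity.\<close>

lemma nat_trans_yoneda:
  assumes T: "T \<subseteq> Obj C" and X: "X \<in> T" and F: "additive_cfunctor C T F" and e: "e \<in> carrier (fobj F X)"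
  shows "nat_trans C T (Hfun C X) F (\<lambda>S x. fmap F x e)"
  unfolding nat_trans_def
proof (intro conjI ballI)
  fix S assume S: "S \<in> T"
  show "(\<lambda>x. fmap F x e) \<in> hom (fobj (Hfun C X) S) (fobj F S)"
  proof (rule homI)
    fix x y assume x: "x \<in> carrier (fobj (Hfun C X) S)" and y: "y \<in> carrier (fobj (Hfun C X) S)"
    have "fmap F x \<in> hom (fobj F X) (fobj F S)"
      using F S X x unfolding additive_cfunctor_def by (simp add: Hfun_simps)
    then show "fmap F x e \<in> carrier (fobj F S)" using e by (auto simp: hom_def)
    show "fmap F (x \<otimes>\<^bsub>fobj (Hfun C X) S\<^esub> y) e = fmap F x e \<otimes>\<^bsub>fobj F S\<^esub> fmap F y e"
      using F S X x y e unfolding additive_cfunctor_def by (simp add: Hfun_simps)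
  qed
  show "fmap F (fmap (Hfun C X) f x) e = fmap F f (fmap F x e)"
    if "S' \<in> T" "f \<in> arr C S S'" "x \<in> carrier (fobj (Hfun C X) S')" for S' f x
    using F S X that e unfolding additive_cfunctor_def by (simp add: Hfun_simps)
qed

lemma nat_trans_Hfun_apply:
  assumes T: "T \<subseteq> Obj C" and X: "X \<in> T" and \<eta>: "nat_trans C T (Hfun C X) F \<eta>"
    and S: "S \<in> T" and x: "x \<in> arr C S X"
  shows "\<eta> S x = fmap F x (\<eta> X (idm C X))"
proof -
  have "X \<in> Obj C" "S \<in> Obj C" using X S T by blast+
  then show ?thesis
    using \<eta> S X x id_closed[of X] id_left[of S X x] unfolding nat_trans_def
    by (force simp: Hfun_simps)
qed

lemma nat_trans_closed:
  "nat_trans C T F G \<eta> \<Longrightarrow> S \<in> T \<Longrightarrow> x \<in> carrier (fobj F S) \<Longrightarrow> \<eta> S x \<in> carrier (fobj G S)"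
  unfolding nat_trans_def hom_def by blast

lemma nat_trans_natural:
  "nat_trans C T F G \<eta> \<Longrightarrow> S \<in> T \<Longrightarrow> S' \<in> T \<Longrightarrow> f \<in> arr C S S' \<Longrightarrow> x \<in> carrier (fobj F S') \<Longrightarrow>
    \<eta> S (fmap F f x) = fmap G f (\<eta> S' x)"
  unfolding nat_trans_def by blast

lemma nat_trans_comp:
  assumes "nat_trans C T F G \<eta>" "nat_trans C T G H \<theta>"
  shows "nat_trans C T F H (\<lambda>S x. \<theta> S (\<eta> S x))"
  unfolding nat_trans_def
proof (intro conjI ballI)
  fix S assume S: "S \<in> T"
  then have "\<eta> S \<in> hom (fobj F S) (fobj G S)" "\<theta> S \<in> hom (fobj G S) (fobj H S)"
    using assms by (simp_all add: nat_trans_def)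
  then show "(\<lambda>x. \<theta> S (\<eta> S x)) \<in> hom (fobj F S) (fobj H S)"
    unfolding hom_def by fastforce
  show "\<theta> S (\<eta> S (fmap F f x)) = fmap H f (\<theta> S' (\<eta> S' x))"
    if S': "S' \<in> T" and f: "f \<in> arr C S S'" and x: "x \<in> carrier (fobj F S')" for S' f x
    using nat_trans_natural[OF assms(1) S S' f x]
      nat_trans_natural[OF assms(2) S S' f nat_trans_closed[OF assms(1) S' x]] by simp
qed

text \<open>By Yoneda a lift is the same as an element, and a preimage of
  \<open>\<phi> X (idm C X)\<close> under the surjection \<open>\<pi> X\<close> is one.\<close>

lemma projective_Hfun:
  assumes T: "T \<subseteq> Obj C" and X: "X \<in> T"
  shows "projective C T (Hfun C X)"
  unfolding projective_def
proof (intro conjI ballI allI impI)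
  show "Hfun C X \<in> mod_cat C T" using Hfun_mod_cat[OF assms] .
  fix E F \<pi> \<phi>
  assume E: "E \<in> mod_cat C T"
    and "nat_trans C T E F \<pi> \<and> epi T E F \<pi> \<and> nat_trans C T (Hfun C X) F \<phi>"
  then have \<pi>: "nat_trans C T E F \<pi>" "epi T E F \<pi>" and \<phi>: "nat_trans C T (Hfun C X) F \<phi>" by auto
  have "\<phi> X (idm C X) \<in> carrier (fobj F X)"
    using nat_trans_closed[OF \<phi> X] id_closed T X by (auto simp: Hfun_simps)
  then obtain e where e: "e \<in> carrier (fobj E X)" "\<pi> X e = \<phi> X (idm C X)"
    using \<pi>(2) X unfolding epi_def by (metis imageE)
  have "\<pi> S (fmap E x e) = \<phi> S x" if S: "S \<in> T" and x: "x \<in> carrier (fobj (Hfun C X) S)" for S x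
    using nat_trans_natural[OF \<pi>(1) S X _ e(1)] nat_trans_Hfun_apply[OF T X \<phi> S] x e(2)
    by (simp add: Hfun_simps)
  moreover have "nat_trans C T (Hfun C X) E (\<lambda>S x. fmap E x e)"
    using nat_trans_yoneda[OF T X _ e(1)] E by (simp add: mod_cat_def)
  ultimately show "\<exists>\<psi>. nat_trans C T (Hfun C X) E \<psi> \<and>
      (\<forall>S \<in> T. \<forall>x \<in> carrier (fobj (Hfun C X) S). \<pi> S (\<psi> S x) = \<phi> S x)"
    by (intro exI[of _ "\<lambda>S x. fmap E x e"]) simp
qed

text \<open>Projectivity tests only epimorphisms between objects of \<open>mod_cat\<close>, while
  the image of \<open>f \<bullet> -\<close> has not been shown to be finitely presented. So
  \<open>P\<close> is first split off a representable functor, and then a single preimage under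
  \<open>f \<bullet> -\<close> determines the lift.\<close>

lemma projective_lift:
  assumes T: "T \<subseteq> Obj C" and P: "projective C T P" and f: "mor f A B" and A: "A \<in> T"
    and \<chi>: "nat_trans C T P (Hfun C B) \<chi>"
    and im: "\<And>S u. S \<in> T \<Longrightarrow> u \<in> carrier (fobj P S) \<Longrightarrow> \<exists>y. mor y S A \<and> f \<bullet> y = \<chi> S u"
  obtains \<psi> where "nat_trans C T P (Hfun C A) \<psi>"
    "\<And>S u. S \<in> T \<Longrightarrow> u \<in> carrier (fobj P S) \<Longrightarrow> f \<bullet> \<psi> S u = \<chi> S u"
proof -
  have Pm: "P \<in> mod_cat C T" using P by (simp add: projective_def)
  then obtain U \<beta> where U: "U \<in> T" and \<beta>: "nat_trans C T (Hfun C U) P \<beta>" "epi T (Hfun C U) P \<beta>"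
    unfolding mod_cat_def finitely_presented_def by blast
  have Uo: "U \<in> Obj C" using T U by blast
  \<comment> \<open>Lifting the identity of \<open>P\<close> along the presentation map
    \<open>\<beta>\<close> gives a section \<open>\<tau>\<close>.\<close>
  have "nat_trans C T P P (\<lambda>S x. x)" by (auto simp: nat_trans_def hom_def)
  then obtain \<tau> where \<tau>: "nat_trans C T P (Hfun C U) \<tau>"
    "\<forall>S \<in> T. \<forall>x \<in> carrier (fobj P S). \<beta> S (\<tau> S x) = x"
    using P \<beta> Pm Hfun_mod_cat[OF T U] unfolding projective_def by blast
  \<comment> \<open>The universal element: by Yoneda \<open>\<beta>\<close> sends \<open>x\<close>
    to \<open>fmap P x u\<close>, so each \<open>x\<close> in \<open>P\<close> equals
    \<open>fmap P (\<tau> S x) u\<close>.\<close>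
  define u where "u = \<beta> U (idm C U)"
  have u: "u \<in> carrier (fobj P U)"
    unfolding u_def using nat_trans_closed[OF \<beta>(1) U] id_closed[OF Uo] by (simp add: Hfun_simps)
  obtain y where y: "mor y U A" "f \<bullet> y = \<chi> U u" using im[OF U u] by blast
  show thesis
  proof (rule that[OF nat_trans_comp[OF \<tau>(1) nat_trans_Hfun[OF T y(1)]]])
    fix S x assume S: "S \<in> T" and x: "x \<in> carrier (fobj P S)"
    have t: "\<tau> S x \<in> arr C S U" using nat_trans_closed[OF \<tau>(1) S x] by (simp add: Hfun_simps)
    then have tm: "mor (\<tau> S x) S U" using S T Uo by (auto simp: mor_def)
    have "f \<bullet> (y \<bullet> \<tau> S x) = \<chi> U u \<bullet> \<tau> S x" using assoc_mor[OF tm y(1) f] y(2) by simp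
    also have "\<dots> = \<chi> S (fmap P (\<tau> S x) u)"
      using nat_trans_natural[OF \<chi> S U t u] by (simp add: Hfun_simps)
    also have "fmap P (\<tau> S x) u = x"
      using nat_trans_Hfun_apply[OF T U \<beta>(1) S t] \<tau>(2) S x unfolding u_def by simp
    finally show "f \<bullet> (y \<bullet> \<tau> S x) = \<chi> S x" .
  qed
qed

section \<open>Comparison of projective presentations and the kernel of
  \<open>f \<bullet> -\<close>\<close>

lemma fmap_zero_mor:
  assumes F: "additive_cfunctor C T F" and "T \<subseteq> Obj C" "S \<in> T" "S' \<in> T" and x: "x \<in> carrier (fobj F S')"
  shows "fmap F (zero_mor S S') x = \<one>\<^bsub>fobj F S\<^esub>"
proof -
  have z: "mor (zero_mor S S') S S'" using assms by (intro mor_zero) auto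
  interpret comm_group "fobj F S" using assms unfolding additive_cfunctor_def by blast
  have "fmap F (zero_mor S S') \<in> hom (fobj F S') (fobj F S)"
    using assms morD(3)[OF z] unfolding additive_cfunctor_def by blast
  then have y: "fmap F (zero_mor S S') x \<in> carrier (fobj F S)" using x by (auto simp: hom_def)
  have "fmap F (zero_mor S S') x = fmap F (plus_mor S S' (zero_mor S S') (zero_mor S S')) x"
    using plus_zero_mor(1)[OF z] by simp
  also have "\<dots> = fmap F (zero_mor S S') x \<otimes>\<^bsub>fobj F S\<^esub> fmap F (zero_mor S S') x"
    using F assms(3,4) x morD(3)[OF z] unfolding additive_cfunctor_def by blast
  finally show ?thesis using y by (metis l_cancel_one')
qed

text \<open>A comparison of two projective presentations: \<open>e\<close> is the projection of \<open>Hom(-, T1)\<close>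
  onto the kernel of \<open>f \<bullet> -\<close>, which splits off because the image of \<open>f \<bullet> -\<close> is projective.\<close>

lemma kernel_projection:
  assumes T: "T \<subseteq> Obj C" and T1: "T1 \<in> T" and T0: "T0 \<in> T" and f: "mor f T1 T0" and g: "mor g T0 X"
    and gf: "g \<bullet> f = zero_mor T1 X"
    and ex: "\<And>S a. S \<in> T \<Longrightarrow> mor a S T0 \<Longrightarrow> g \<bullet> a = zero_mor S X \<Longrightarrow> \<exists>b. mor b S T1 \<and> a = f \<bullet> b"
    and sur: "\<And>S a. S \<in> T \<Longrightarrow> mor a S X \<Longrightarrow> \<exists>b. mor b S T0 \<and> a = g \<bullet> b"
    and P0: "projective C T P0" and P1: "projective C T P1"
    and \<delta>: "nat_trans C T P1 P0 \<delta>" and \<epsilon>: "nat_trans C T P0 (Hfun C X) \<epsilon>"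
    and epi: "epi T P0 (Hfun C X) \<epsilon>" and exact: "exact_at T P1 P0 (Hfun C X) \<delta> \<epsilon>"
    and inj: "\<And>S u. S \<in> T \<Longrightarrow> u \<in> carrier (fobj P1 S) \<Longrightarrow> \<delta> S u = \<one>\<^bsub>fobj P0 S\<^esub> \<Longrightarrow> u = \<one>\<^bsub>fobj P1 S\<^esub>"
  obtains e where "mor e T1 T1" "f \<bullet> e = zero_mor T1 T0"
    "\<And>S x. S \<in> T \<Longrightarrow> mor x S T1 \<Longrightarrow> f \<bullet> x = zero_mor S T0 \<Longrightarrow> e \<bullet> x = x"
proof -
  have obj: "T1 \<in> Obj C" "T0 \<in> Obj C" "X \<in> Obj C" using f g morD by blast+
  have add: "additive_cfunctor C T P0" "additive_cfunctor C T P1"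
    using P0 P1 by (auto simp: projective_def mod_cat_def)
  have \<epsilon>_mor: "mor (\<epsilon> S u) S X" if "S \<in> T" "u \<in> carrier (fobj P0 S)" for S u
    using nat_trans_closed[OF \<epsilon> that] that T obj by (auto simp: Hfun_simps mor_def)
  have \<epsilon>\<delta>: "\<epsilon> S (\<delta> S u) = zero_mor S X" if "S \<in> T" "u \<in> carrier (fobj P1 S)" for S u
    using exact that unfolding exact_at_def kernel_def by (auto simp: Hfun_simps)
  \<comment> \<open>By Yoneda, \<open>p0\<close> is the comparison map from
    \<open>Hom(-, T0)\<close> to \<open>P0\<close> over \<open>\<H> X\<close>.\<close>
  obtain p0 where p0: "p0 \<in> carrier (fobj P0 T0)" "\<epsilon> T0 p0 = g"
  proof -
    have "g \<in> \<epsilon> T0 ` carrier (fobj P0 T0)"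
      using epi T0 morD(3)[OF g] unfolding epi_def by (simp add: Hfun_simps)
    then show thesis using that by blast
  qed
  \<comment> \<open>\<open>q\<close> represents the composite of that comparison with
    \<open>f\<close>. It is killed by \<open>\<epsilon>\<close>, so exactness lifts it to
    \<open>p1\<close>, the comparison map from \<open>Hom(-, T1)\<close> to
    \<open>P1\<close>.\<close>
  define q where "q = fmap P0 f p0"
  have q: "q \<in> carrier (fobj P0 T1)"
    using nat_trans_closed[OF nat_trans_yoneda[OF T T0 add(1) p0(1)] T1, of f] morD(3)[OF f]
    unfolding q_def by (simp add: Hfun_simps)
  have "\<epsilon> T1 q = zero_mor T1 X"
    using nat_trans_natural[OF \<epsilon> T1 T0 morD(3)[OF f] p0(1)] p0(2) gf unfolding q_def
    by (simp add: Hfun_simps)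
  then have "q \<in> \<delta> T1 ` carrier (fobj P1 T1)"
    using exact T1 q unfolding exact_at_def kernel_def by (simp add: Hfun_simps)
  then obtain p1 where p1: "p1 \<in> carrier (fobj P1 T1)" "\<delta> T1 p1 = q" by blast
  \<comment> \<open>The comparison maps in the opposite direction are \<open>\<psi>\<close> in
    degree 0 and \<open>\<psi>'\<close> in degree 1.\<close>
  obtain \<psi> where \<psi>: "nat_trans C T P0 (Hfun C T0) \<psi>"
    "\<And>S u. S \<in> T \<Longrightarrow> u \<in> carrier (fobj P0 S) \<Longrightarrow> g \<bullet> \<psi> S u = \<epsilon> S u"
  proof (rule projective_lift[OF T P0 g T0 \<epsilon>])
    show "\<exists>y. mor y S T0 \<and> g \<bullet> y = \<epsilon> S u" if "S \<in> T" "u \<in> carrier (fobj P0 S)" for S u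
      using sur[OF that(1) \<epsilon>_mor[OF that]] by metis
  qed (rule that)
  have \<psi>_mor: "mor (\<psi> S u) S T0" if "S \<in> T" "u \<in> carrier (fobj P0 S)" for S u
    using nat_trans_closed[OF \<psi>(1) that] that T obj by (auto simp: Hfun_simps mor_def)
  obtain \<psi>' where \<psi>': "nat_trans C T P1 (Hfun C T1) \<psi>'"
    "\<And>S u. S \<in> T \<Longrightarrow> u \<in> carrier (fobj P1 S) \<Longrightarrow> f \<bullet> \<psi>' S u = \<psi> S (\<delta> S u)"
  proof (rule projective_lift[OF T P1 f T1 nat_trans_comp[OF \<delta> \<psi>(1)]])
    fix S u assume S: "S \<in> T" and u: "u \<in> carrier (fobj P1 S)"
    note \<delta>u = nat_trans_closed[OF \<delta> S u]
    have "g \<bullet> \<psi> S (\<delta> S u) = zero_mor S X" using \<psi>(2)[OF S \<delta>u] \<epsilon>\<delta>[OF S u] by simp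
    then show "\<exists>y. mor y S T1 \<and> f \<bullet> y = \<psi> S (\<delta> S u)"
      using ex[OF S \<psi>_mor[OF S \<delta>u]] by metis
  qed (rule that)
  \<comment> \<open>The round trip through \<open>P0\<close> is composition with \<open>a\<close>.
    It lies over \<open>\<H> X\<close>, so \<open>1 - a\<close> is killed by \<open>g\<close> and
    factors as \<open>f \<bullet> \<kappa>\<close>; here \<open>\<kappa>\<close> is the
    homotopy.\<close>
  define a where "a = \<psi> T0 p0"
  have a: "mor a T0 T0" "g \<bullet> a = g" unfolding a_def using \<psi>_mor[OF T0 p0(1)] \<psi>(2)[OF T0 p0(1)] p0(2) by auto
  have ida: "mor (minus_mor T0 T0 (idm C T0) a) T0 T0" using mor_minus[OF mor_id[OF obj(2)] a(1)] .
  have "g \<bullet> minus_mor T0 T0 (idm C T0) a = zero_mor T0 X"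
    using comp_minus[OF mor_id[OF obj(2)] a(1) g] id_right_mor[OF g] a(2) minus_mor_self[OF g] by simp
  then obtain \<kappa> where \<kappa>: "mor \<kappa> T0 T1" "minus_mor T0 T0 (idm C T0) a = f \<bullet> \<kappa>"
    using ex[OF T0 ida] by blast
  \<comment> \<open>The round trip through \<open>P1\<close> is composition with \<open>w\<close>,
    and the comparison squares give \<open>f w = a f\<close>.\<close>
  define w where "w = \<psi>' T1 p1"
  have w: "mor w T1 T1"
    unfolding w_def using nat_trans_closed[OF \<psi>'(1) T1 p1(1)] obj by (simp add: Hfun_simps mor_def)
  have fw: "f \<bullet> w = a \<bullet> f"
    unfolding w_def a_def using \<psi>'(2)[OF T1 p1(1)] p1(2)
      nat_trans_natural[OF \<psi>(1) T1 T0 morD(3)[OF f] p0(1)] by (simp add: q_def Hfun_simps)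
  have \<kappa>f: "mor (\<kappa> \<bullet> f) T1 T1" using f \<kappa> mor_comp by blast
  have idw: "mor (minus_mor T1 T1 (idm C T1) w) T1 T1" using mor_minus[OF mor_id[OF obj(1)] w] .
  \<comment> \<open>\<open>e\<close> is the defect of the homotopy in degree 1:
    \<open>f e = f - a f - (1 - a) f = 0\<close>.\<close>
  define e where "e = minus_mor T1 T1 (minus_mor T1 T1 (idm C T1) w) (\<kappa> \<bullet> f)"
  have e: "mor e T1 T1" unfolding e_def using mor_minus[OF idw \<kappa>f] .
  have af: "mor (a \<bullet> f) T1 T0" using mor_comp[OF f a(1)] .
  have "f \<bullet> (\<kappa> \<bullet> f) = minus_mor T1 T0 f (a \<bullet> f)"
    using assoc_mor[OF f \<kappa>(1) f] \<kappa>(2) minus_comp[OF f mor_id[OF obj(2)] a(1)] id_left_mor[OF f] by simp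
  then have "f \<bullet> e = zero_mor T1 T0"
    unfolding e_def using comp_minus[OF idw \<kappa>f f] comp_minus[OF mor_id[OF obj(1)] w f]
      id_right_mor[OF f] fw minus_mor_self[OF mor_minus[OF f af]] by simp
  moreover have "e \<bullet> x = x" if S: "S \<in> T" and x: "mor x S T1" and fx: "f \<bullet> x = zero_mor S T0" for S x
  proof -
    note x' = morD(3)[OF x]
    \<comment> \<open>\<open>v\<close> is the image of \<open>x\<close> in \<open>P1\<close>. Since
      \<open>\<delta>\<close> sends it to the element induced by \<open>f \<bullet> x = 0\<close>,
      injectivity gives \<open>v = 0\<close>. Hence \<open>w x = 0\<close>; as
      \<open>\<kappa> f x = 0\<close> too, \<open>e x = x\<close>.\<close>
    define v where "v = fmap P1 x p1"
    have v: "v \<in> carrier (fobj P1 S)"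
      using nat_trans_closed[OF nat_trans_yoneda[OF T T1 add(2) p1(1)] S, of x] x'
      unfolding v_def by (simp add: Hfun_simps)
    have "\<delta> S v = fmap P0 x (fmap P0 f p0)"
      unfolding v_def using nat_trans_natural[OF \<delta> S T1 x' p1(1)] p1(2) q_def by simp
    also have "\<dots> = fmap P0 (f \<bullet> x) p0"
      using add(1) S T1 T0 x' morD(3)[OF f] p0(1) unfolding additive_cfunctor_def by simp
    also have "\<dots> = \<one>\<^bsub>fobj P0 S\<^esub>"
      using fmap_zero_mor[OF add(1) T S T0 p0(1)] fx by simp
    finally have "v = \<one>\<^bsub>fobj P1 S\<^esub>" using inj[OF S v] by blast
    moreover have "\<psi>' S \<one>\<^bsub>fobj P1 S\<^esub> = zero_mor S T1"
    proof -
      have "\<psi>' S \<in> hom (fobj P1 S) (fobj (Hfun C T1) S)" using \<psi>'(1) S unfolding nat_trans_def by blast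
      moreover have "group (fobj P1 S)"
        using add(2) S unfolding additive_cfunctor_def by (simp add: comm_group.axioms(2))
      moreover have "group (fobj (Hfun C T1) S)"
        using comm_group_Hfun[of S T1] obj S T by (auto simp: comm_group.axioms(2))
      ultimately show ?thesis using hom_one by (force simp: Hfun_simps)
    qed
    ultimately have wx: "w \<bullet> x = zero_mor S T1"
      using nat_trans_natural[OF \<psi>'(1) S T1 x' p1(1)] unfolding w_def v_def by (simp add: Hfun_simps)
    have "(\<kappa> \<bullet> f) \<bullet> x = zero_mor S T1"
      using assoc_mor[OF x f \<kappa>(1)] fx comp_zero[OF \<kappa>(1) morD(1)[OF x]] by simp
    then show ?thesis
      unfolding e_def using minus_comp[OF x idw \<kappa>f] minus_comp[OF x mor_id[OF obj(1)] w]
        id_left_mor[OF x] wx minus_mor_zero[OF x] by simp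
  qed
  ultimately show thesis using that e by blast
qed

section \<open>Projective dimension at most one\<close>

text \<open>When \<open>\<H> f\<close> is mono, the presentation is already a resolution. It is
  continued by the functor represented by a zero object of \<open>T\<close>, which is projective
  like every functor represented in \<open>T\<close>.\<close>

lemma proj_dim_le_one_resolution:
  assumes T: "T \<subseteq> Obj C" and Z: "Z \<in> T" "is_zero_obj C Z"
    and T1: "T1 \<in> T" and T0: "T0 \<in> T" and f: "mor f T1 T0" and g: "mor g T0 X"
    and gf: "g \<bullet> f = zero_mor T1 X"
    and ex: "\<And>S a. S \<in> T \<Longrightarrow> mor a S T0 \<Longrightarrow> g \<bullet> a = zero_mor S X \<Longrightarrow> \<exists>b. mor b S T1 \<and> a = f \<bullet> b"
    and sur: "\<And>S a. S \<in> T \<Longrightarrow> mor a S X \<Longrightarrow> \<exists>b. mor b S T0 \<and> a = g \<bullet> b"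
    and mono: "\<And>S x. S \<in> T \<Longrightarrow> mor x S T1 \<Longrightarrow> f \<bullet> x = zero_mor S T0 \<Longrightarrow> x = zero_mor S T1"
  shows "proj_dim C T (Hfun C X) \<le> 1"
proof -
  have obj: "T1 \<in> Obj C" "T0 \<in> Obj C" "X \<in> Obj C" "Z \<in> Obj C" using f g T Z morD by blast+
  define Q where "Q n = (if n = 0 then T0 else if n = 1 then T1 else Z)" for n :: nat
  define d where "d n = (if n = 0 then f else zero_mor (Q (Suc n)) (Q n))" for n :: nat
  have Q: "Q n \<in> T" for n using T0 T1 Z by (simp add: Q_def)
  then have Qo: "Q n \<in> Obj C" for n using T by blast
  have d: "mor (d n) (Q (Suc n)) (Q n)" for n
    using f mor_zero[OF Qo Qo] by (simp add: d_def) (simp add: Q_def)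
  have exd: "exact_at T (Hfun C (Q (Suc (Suc n)))) (Hfun C (Q (Suc n))) (Hfun C (Q n))
      (\<lambda>S x. d (Suc n) \<bullet> x) (\<lambda>S x. d n \<bullet> x)" for n
  proof (rule exact_Hfun[OF T d d])
    show "d n \<bullet> d (Suc n) = zero_mor (Q (Suc (Suc n))) (Q n)"
      using comp_zero[OF d Qo, of n] by (simp add: d_def)
    fix S a assume S: "S \<in> T" and a: "mor a S (Q (Suc n))" and da: "d n \<bullet> a = zero_mor S (Q n)"
    have "a = zero_mor S (Q (Suc n))"
    \<comment> \<open>The case 0 is exactness at \<open>T1\<close>, where injectivity of
      \<open>f \<bullet> -\<close> enters; all later terms are the zero object.\<close>
    proof (cases n)
      case 0
      then show ?thesis using mono[OF S] a da by (simp add: d_def Q_def)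
    next
      case (Suc m)
      then show ?thesis using zero_obj_mor[OF Z(2) a] by (simp add: Q_def)
    qed
    moreover have "d (Suc n) \<bullet> zero_mor S (Q (Suc (Suc n))) = zero_mor S (Q (Suc n))"
      using comp_zero[OF d] morD(1)[OF a] by blast
    ultimately show "\<exists>b. mor b S (Q (Suc (Suc n))) \<and> a = d (Suc n) \<bullet> b"
      using mor_zero[OF morD(1)[OF a] Qo] by metis
  qed
  have exg: "exact_at T (Hfun C (Q 1)) (Hfun C (Q 0)) (Hfun C X) (\<lambda>S x. d 0 \<bullet> x) (\<lambda>S x. g \<bullet> x)"
  proof -
    have "exact_at T (Hfun C T1) (Hfun C T0) (Hfun C X) (\<lambda>S x. f \<bullet> x) (\<lambda>S x. g \<bullet> x)"
      by (rule exact_Hfun[OF T f g gf ex])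
    then show ?thesis by (simp add: Q_def d_def)
  qed
  have "epi T (Hfun C (Q 0)) (Hfun C X) (\<lambda>S x. g \<bullet> x)"
    unfolding epi_def
  proof (intro ballI equalityI subsetI)
    fix S a assume S: "S \<in> T" then have So: "S \<in> Obj C" using T by blast
    show "a \<in> carrier (fobj (Hfun C X) S)" if "a \<in> (\<lambda>x. g \<bullet> x) ` carrier (fobj (Hfun C (Q 0)) S)"
      using that comp_closed[OF So obj(2,3) _ morD(3)[OF g]] by (auto simp: Hfun_simps Q_def)
    show "a \<in> (\<lambda>x. g \<bullet> x) ` carrier (fobj (Hfun C (Q 0)) S)" if "a \<in> carrier (fobj (Hfun C X) S)"
      using that sur[OF S, of a] So obj by (auto simp: Hfun_simps Q_def mor_def)
  qed
  moreover have "nat_trans C T (Hfun C (Q 0)) (Hfun C X) (\<lambda>S x. g \<bullet> x)"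
    using nat_trans_Hfun[OF T g] by (simp add: Q_def)
  ultimately have "proj_resolution C T (Hfun C X) (\<lambda>n. Hfun C (Q n)) (\<lambda>n S x. d n \<bullet> x) (\<lambda>S x. g \<bullet> x)"
    unfolding proj_resolution_def using projective_Hfun[OF T Q] nat_trans_Hfun[OF T d] exd exg by blast
  moreover have "\<forall>n > 1. is_zero_cfunctor T (Hfun C (Q n))"
    using Z(2) T by (auto simp: Q_def is_zero_cfunctor_def Hfun_simps is_zero_obj_def)
  ultimately have "enat 1 \<in> {enat n | n. \<exists>P d \<epsilon>. proj_resolution C T (Hfun C X) P d \<epsilon> \<and>
      (\<forall>i > n. is_zero_cfunctor T (P i))}" by blast
  then show ?thesis unfolding proj_dim_def one_enat_def by (rule Inf_lower)
qed

text \<open>A finite infimum of lengths is attained, so a resolution of length at most one exists.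
  Its term \<open>P 2\<close> is zero, and exactness at \<open>P 1\<close> makes the first
  differential injective.\<close>

lemma proj_dim_le_oneE:
  assumes "proj_dim C T F \<le> 1"
  obtains P0 P1 \<delta> \<epsilon> where "projective C T P0" "projective C T P1"
    "nat_trans C T P1 P0 \<delta>" "nat_trans C T P0 F \<epsilon>" "epi T P0 F \<epsilon>" "exact_at T P1 P0 F \<delta> \<epsilon>"
    "\<And>S u. S \<in> T \<Longrightarrow> u \<in> carrier (fobj P1 S) \<Longrightarrow> \<delta> S u = \<one>\<^bsub>fobj P0 S\<^esub> \<Longrightarrow> u = \<one>\<^bsub>fobj P1 S\<^esub>"
proof -
  define A where "A = {enat n | n. \<exists>P d \<epsilon>. proj_resolution C T F P d \<epsilon> \<and>
      (\<forall>i > n. is_zero_cfunctor T (P i))}"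
  have le: "Inf A \<le> 1" using assms unfolding proj_dim_def A_def .
  \<comment> \<open>The infimum of the empty set is \<open>\<infinity>\<close>; on a nonempty set it
    is the least element.\<close>
  then have "A \<noteq> {}" by (auto simp: Inf_enat_def one_enat_def)
  then have "Inf A \<in> A" unfolding Inf_enat_def by (auto intro: LeastI)
  then obtain n P d \<epsilon> where n: "Inf A = enat n" and res: "proj_resolution C T F P d \<epsilon>"
    and zero: "\<forall>i > n. is_zero_cfunctor T (P i)"
    unfolding A_def by blast
  have "n \<le> 1" using le n by (simp add: one_enat_def)
  then have Z: "is_zero_cfunctor T (P 2)" using zero by simp
  have proj: "\<And>i. projective C T (P i)" and nt: "\<And>i. nat_trans C T (P (Suc i)) (P i) (d i)"
    and \<epsilon>: "nat_trans C T (P 0) F \<epsilon>" "epi T (P 0) F \<epsilon>" "exact_at T (P 1) (P 0) F (d 0) \<epsilon>"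
    and ex: "\<And>i. exact_at T (P (Suc (Suc i))) (P (Suc i)) (P i) (d (Suc i)) (d i)"
    using res unfolding proj_resolution_def by blast+
  have inj: "u = \<one>\<^bsub>fobj (P 1) S\<^esub>"
    if S: "S \<in> T" and u: "u \<in> carrier (fobj (P 1) S)" "d 0 S u = \<one>\<^bsub>fobj (P 0) S\<^esub>" for S u
  proof -
    have "group (fobj (P i) S)" for i
      using proj[of i] S
      unfolding projective_def mod_cat_def additive_cfunctor_def by (auto simp: comm_group.axioms(2))
    moreover have "d 1 S \<in> hom (fobj (P 2) S) (fobj (P 1) S)"
      using nt[of 1] S unfolding nat_trans_def by (simp add: numeral_2_eq_2)
    ultimately have "d 1 S \<one>\<^bsub>fobj (P 2) S\<^esub> = \<one>\<^bsub>fobj (P 1) S\<^esub>" using hom_one by blast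
    moreover have "carrier (fobj (P 2) S) = {\<one>\<^bsub>fobj (P 2) S\<^esub>}"
      using Z S unfolding is_zero_cfunctor_def by blast
    moreover have "u \<in> d 1 S ` carrier (fobj (P 2) S)"
      using ex[of 0] S u unfolding exact_at_def kernel_def by (simp add: numeral_2_eq_2)
    ultimately show ?thesis by auto
  qed
  show thesis
    by (rule that[OF proj[of 0] proj[of 1] _ \<epsilon>(1,2,3) inj]) (use nt[of 0] in simp_all)
qed

end

section \<open>Both conditions are compared with injectivity of \<open>\<H> f\<close>\<close>

theorem theorem4p2:
  fixes k :: "('k, 'r) ring_scheme"
    and C :: "('k, 'o, 'm, 'z) tri_cat_scheme"
    and T :: "'o set"
    and X :: 'o
  assumes "triangulated_category k C"
    and "hom_finite k C"
    and "krull_schmidt C"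
    and "closed_subcategory C T"
    and "rigid C T"
    and "contravariantly_finite C T"
    and "X \<in> star C T (shift_subcat C T)"
    and "\<And>Y. is_direct_summand C Y X \<Longrightarrow> Y \<in> shift_subcat C T \<Longrightarrow> is_zero_obj C Y"
  shows "proj_dim C T (Hfun C X) \<le> 1 \<longleftrightarrow> factor_ideal_zero C X (shift_subcat C T)"
proof -
  interpret triangulated_category k C by fact
  have T: "T \<subseteq> Obj C" using assms(4) by (simp add: closed_subcategory_def)
  obtain T1 T0 f g h where T1: "T1 \<in> T" and T0: "T0 \<in> T" and t: "dtri C T1 T0 X f g h"
    using star_triangle[OF assms(4,7)] by blast
  note m = dtri_mor[OF t]
  note gf = dtri_comp_zero[OF t]
  have shT1: "sh C T1 \<in> shift_subcat C T" using sh_in_shift_subcat[OF assms(4) T1] .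
  have ex: "\<exists>b. mor b S T1 \<and> a = f \<bullet>\<^bsub>C\<^esub> b"
    if "S \<in> T" "mor a S T0" "g \<bullet>\<^bsub>C\<^esub> a = zero_mor S X" for S a
    using dtri_exact_cov[OF t that(2,3)] by blast
  \<comment> \<open>Rigidity gives \<open>h \<bullet> a = 0\<close>, since this composite goes from
    \<open>S\<close> to \<open>T1[1]\<close>; hence \<open>a\<close> factors through
    \<open>g\<close>.\<close>
  have sur: "\<exists>b. mor b S T0 \<and> a = g \<bullet>\<^bsub>C\<^esub> b" if "S \<in> T" "mor a S X" for S a
    using dtri_exact_cov[OF dtri_rotate[OF t] that(2)]
      rigid_shift_subcat[OF assms(4,5) that(1) shT1 mor_comp[OF that(2) m(3)]] by blast
  have "proj_dim C T (Hfun C X) \<le> 1 \<longleftrightarrow>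
      (\<forall>S \<in> T. \<forall>x. mor x S T1 \<and> f \<bullet>\<^bsub>C\<^esub> x = zero_mor S T0 \<longrightarrow> x = zero_mor S T1)"
  proof
    assume "proj_dim C T (Hfun C X) \<le> 1"
    then obtain P0 P1 \<delta> \<epsilon> where "projective C T P0" "projective C T P1"
      "nat_trans C T P1 P0 \<delta>" "nat_trans C T P0 (Hfun C X) \<epsilon>" "epi T P0 (Hfun C X) \<epsilon>"
      "exact_at T P1 P0 (Hfun C X) \<delta> \<epsilon>"
      "\<And>S u. S \<in> T \<Longrightarrow> u \<in> carrier (fobj P1 S) \<Longrightarrow> \<delta> S u = \<one>\<^bsub>fobj P0 S\<^esub> \<Longrightarrow> u = \<one>\<^bsub>fobj P1 S\<^esub>"
      by (rule proj_dim_le_oneE) (rule that)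
    then obtain e where e: "mor e T1 T1" "f \<bullet>\<^bsub>C\<^esub> e = zero_mor T1 T0"
      and e_fix: "\<And>S x. S \<in> T \<Longrightarrow> mor x S T1 \<Longrightarrow> f \<bullet>\<^bsub>C\<^esub> x = zero_mor S T0 \<Longrightarrow> e \<bullet>\<^bsub>C\<^esub> x = x"
      using kernel_projection[OF T T1 T0 m(1,2) gf ex sur] by blast
    obtain s where s: "mor s (sh C T1) X" "shm C e = h \<bullet>\<^bsub>C\<^esub> s"
      using dtri_connecting_comp_zero[OF t e(1)] e(2) by blast
    \<comment> \<open>Because \<open>f \<bullet> e = 0\<close>, the projection \<open>e\<close>
      fixes itself, so \<open>e\<close> and its shift are idempotent.\<close>
    have "shm C e \<bullet>\<^bsub>C\<^esub> shm C e = shm C e"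
      using shm_comp_mor[OF e(1) e(1)] e_fix[OF T1 e] by simp
    \<comment> \<open>The idempotent \<open>e[1]\<close> equals \<open>h \<bullet> s\<close>, and
      \<open>h\<close> is radical because \<open>X\<close> has no nonzero summand in
      \<open>T[1]\<close>.\<close>
    then have "shm C e = zero_mor (sh C T1) (sh C T1)"
      using idempotent_through_radical[OF radical_into_shift_subcat[OF assms(3,4,8) shT1 m(3)] s(1)] s(2)
      by simp
    then have e0: "e = zero_mor T1 T1" using shm_eq_zero[OF e(1)] by blast
    show "\<forall>S \<in> T. \<forall>x. mor x S T1 \<and> f \<bullet>\<^bsub>C\<^esub> x = zero_mor S T0 \<longrightarrow> x = zero_mor S T1"
    proof (intro ballI allI impI)
      fix S x assume S: "S \<in> T" and x: "mor x S T1 \<and> f \<bullet>\<^bsub>C\<^esub> x = zero_mor S T0"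
      then have "x = zero_mor T1 T1 \<bullet>\<^bsub>C\<^esub> x" using e_fix[OF S] e0 by simp
      then show "x = zero_mor S T1" using zero_comp[of x S T1 T1] x morD(1)[OF m(1)] by simp
    qed
  next
    assume mono: "\<forall>S \<in> T. \<forall>x. mor x S T1 \<and> f \<bullet>\<^bsub>C\<^esub> x = zero_mor S T0 \<longrightarrow> x = zero_mor S T1"
    \<comment> \<open>Closure of \<open>T\<close> under direct sums includes the empty one, which
      supplies the zero object for the tail of the resolution.\<close>
    obtain Z where Z: "is_direct_sum C [] Z" using direct_sums_exist[of "[]"] by auto
    have ZT: "Z \<in> T"
      using assms(4)[unfolded closed_subcategory_def, THEN conjunct2, THEN conjunct2, THEN conjunct1,
          rule_format, of "[]" Z] Z by simp
    show "proj_dim C T (Hfun C X) \<le> 1"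
      by (rule proj_dim_le_one_resolution[OF T ZT empty_direct_sum_zero[OF Z] T1 T0 m(1,2) gf ex sur])
        (use mono in blast)+
  qed
  then show ?thesis using factor_ideal_zero_iff[OF assms(4,5) T1 T0 t] by simp
qed

end
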